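(* For each $n \in \mathbb{N}$ let $P_n \in \mathcal{E}_n$ and $\alpha_n \in (0,1)$, and let $\epsilon \in (0,1)$ be independent of $n$. Assume that $\{P_n\}_{n \in \mathbb{N}}$ exhibits cutoff, that each $P_n$ is lazy and reversible, and that $\lim_{n \to \infty} \alpha_n t_{\text{mix}}^{(n)}(\epsilon) = c \in [0,\infty]$. Then the following hold. (i) If $c = 0$, then for every sequence $\{\tilde{P}_n\}_{n\in\mathbb{N}}$ with $\tilde{P}_n \in B(P_n,\alpha_n)$ for all $n \in \mathbb{N}$, $$\lim_{n \to \infty} \| \pi_n - \tilde{\pi}_n \| = 0 .$$ (ii) If $c \in (0,\infty)$, then for every sequence $\{\tilde{P}_n\}_{n\in\mathbb{N}}$ with $\tilde{P}_n \in B(P_n,\alpha_n)$ for all $n \in \mathbb{N}$, $$\limsup_{n \to \infty} \| \pi_n - \tilde{\pi}_n \| \leq 1 - e^{-c} .$$ Furthermore, the bound is tight: there exists a sequence $\{\tilde{P}_n\}_{n\in\mathbb{N}}$ with $\tilde{P}_n \in B(P_n,\alpha_n)$ for all $n \in \mathbb{N}$, where each $\tilde{P}_n$ is a restart perturbation, i.e. $\tilde{P}_n = P_{\alpha_n,\sigma_n}$ for some $\sigma_n \in \Delta_{n-1}$, such that $$\liminf_{n \to \infty} \| \pi_n - \tilde{\pi}_n \| \geq 1 - e^{-c} .$$ (iii) If $c = \infty$, then there exists a sequence $\{\tilde{P}_n\}_{n\in\mathbb{N}}$ with $\tilde{P}_n \in B(P_n,\alpha_n)$ for all $n \in \mathbb{N}$,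 where each $\tilde{P}_n$ is a restart perturbation, i.e. $\tilde{P}_n = P_{\alpha_n,\sigma_n}$ for some $\sigma_n \in \Delta_{n-1}$, such that $$\lim_{n \to \infty} \| \pi_n - \tilde{\pi}_n \| = 1 .$$
   Context: All vectors are row vectors. $[n] = \{1,\ldots,n\}$; $\Delta_{n-1}$ is the set of probability distributions on $[n]$; $e_i$ is the $i$-th standard basis vector; $1_n$ is the length-$n$ row vector of ones; $\mathsf{T}$ denotes transpose. $\|\mu-\nu\| = \max_{A \subset [n]} |\mu(A)-\nu(A)|$ is total variation distance for $\mu,\nu \in \Delta_{n-1}$. $\mathcal{E}_n$ is the set of $n \times n$ transition matrices of time-homogeneous, irreducible, aperiodic Markov chains on state space $[n]$. For $P_n \in \mathcal{E}_n$, $\pi_n$ denotes its unique stationary distribution. $P_n$ is lazy if $P_n(i,i) \geq 1/2$ for all $i \in [n]$, and reversible if $\pi_n(i)P_n(i,j) = \pi_n(j)P_n(j,i)$ for all $i,j \in [n]$. $d_n(t) = \max_{i \in [n]} \|e_i P_n^t - \pi_n\|$ for $t \in \{0,1,2,\ldots\}$, and for $\epsilon \in (0,1)$ the $\epsilon$-mixing time is $t_{\text{mix}}^{(n)}(\epsilon) = \min\{t \in \{0,1,2,\ldots\} : d_n(t) \leq \epsilon\}$. The sequence $\{P_n\}_{n\in\mathbb{N}}$ exhibits cutoff if $\lim_{n\to\infty} t_{\text{mix}}^{(n)}(\epsilon)/t_{\text{mix}}^{(n)}(1-\epsilon) = 1$ for all $\epsilon \in (0,1/2)$. (Since $d_n(0)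 \ge 1-1/n$, the denominator is positive for all $n > 1/\epsilon$.) For $P_n \in \mathcal{E}_n$ and $\alpha \in (0,1)$, $B(P_n,\alpha) = \{\tilde{P}_n \in \mathcal{E}_n : \max_{i\in[n]} \|e_iP_n - e_i\tilde{P}_n\| \leq \alpha\}$. The unique stationary distribution of $\tilde{P}_n \in B(P_n,\alpha)$ is denoted $\tilde{\pi}_n$. For $\sigma_n \in \Delta_{n-1}$, the restart perturbation with restart probability $\alpha$ and restart distribution $\sigma_n$ is $P_{\alpha,\sigma_n} = (1-\alpha)P_n + \alpha 1_n^{\mathsf{T}}\sigma_n \in B(P_n,\alpha)$. *)

theory Defs
  imports "Jordan_Normal_Form.Matrix" "HOL-Library.Extended_Real" "HOL-Library.Liminf_Limsup"
begin

text \<open>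
  The state space of size \<open>n\<close> is \<open>{..<n}\<close> instead of \<open>{1..n}\<close>, following the index convention
  of the matrix library. Probability distributions are real vectors of dimension \<open>n\<close>, read as
  row vectors.
\<close>

definition prob_vecs :: "nat \<Rightarrow> real vec set" where
  "prob_vecs n = {\<mu> \<in> carrier_vec n. (\<forall>i<n. 0 \<le> \<mu> $ i) \<and> (\<Sum>i<n. \<mu> $ i) = 1}"

definition vec_mult_mat :: "real vec \<Rightarrow> real mat \<Rightarrow> real vec"  (infixl \<open>\<^sub>v*\<close> 70) where
  "v \<^sub>v* A = transpose_mat A *\<^sub>v v"

definition tv_dist :: "nat \<Rightarrow> real vec \<Rightarrow> real vec \<Rightarrow> real" where
  "tv_dist n \<mu> \<nu> = Max ((\<lambda>A. \<bar>(\<Sum>i\<in>A. \<mu> $ i) - (\<Sum>i\<in>A. \<nu> $ i)\<bar>) ` Pow {..<n})"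

definition transition_mats :: "nat \<Rightarrow> real mat set" where
  "transition_mats n = {P \<in> carrier_mat n n. \<forall>i<n. row P i \<in> prob_vecs n}"

definition irreducible_mat :: "nat \<Rightarrow> real mat \<Rightarrow> bool" where
  "irreducible_mat n P \<longleftrightarrow> (\<forall>i<n. \<forall>j<n. \<exists>t. 0 < (P ^\<^sub>m t) $$ (i, j))"

definition aperiodic_mat :: "nat \<Rightarrow> real mat \<Rightarrow> bool" where
  "aperiodic_mat n P \<longleftrightarrow> (\<forall>i<n. Gcd {t. 1 \<le> t \<and> 0 < (P ^\<^sub>m t) $$ (i, i)} = 1)"

definition ergodic_mats :: "nat \<Rightarrow> real mat set" where
  "ergodic_mats n = {P \<in> transition_mats n. irreducible_mat n P \<and> aperiodic_mat n P}"

definition stationary_dist :: "nat \<Rightarrow> real mat \<Rightarrow> real vec" where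
  "stationary_dist n P = (THE \<mu>. \<mu> \<in> prob_vecs n \<and> \<mu> \<^sub>v* P = \<mu>)"

definition lazy_mat :: "nat \<Rightarrow> real mat \<Rightarrow> bool" where
  "lazy_mat n P \<longleftrightarrow> (\<forall>i<n. 1 / 2 \<le> P $$ (i, i))"

definition reversible_mat :: "nat \<Rightarrow> real mat \<Rightarrow> bool" where
  "reversible_mat n P \<longleftrightarrow> (\<forall>i<n. \<forall>j<n.
     stationary_dist n P $ i * P $$ (i, j) = stationary_dist n P $ j * P $$ (j, i))"

definition mix_dist :: "nat \<Rightarrow> real mat \<Rightarrow> nat \<Rightarrow> real" where
  "mix_dist n P t =
     Max ((\<lambda>i. tv_dist n (unit_vec n i \<^sub>v* (P ^\<^sub>m t)) (stationary_dist n P)) ` {..<n})"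

definition t_mix :: "nat \<Rightarrow> real mat \<Rightarrow> real \<Rightarrow> nat" where
  "t_mix n P \<epsilon> = (LEAST t. mix_dist n P t \<le> \<epsilon>)"

text \<open>The quotient is meaningful for \<open>n > 1 / \<epsilon>\<close>, where the denominator is positive; the finitely
  many other terms do not affect the limit.\<close>

definition exhibits_cutoff :: "(nat \<Rightarrow> real mat) \<Rightarrow> bool" where
  "exhibits_cutoff P \<longleftrightarrow> (\<forall>\<epsilon>::real. 0 < \<epsilon> \<and> \<epsilon> < 1 / 2 \<longrightarrow>
     (\<lambda>n. real (t_mix n (P n) \<epsilon>) / real (t_mix n (P n) (1 - \<epsilon>))) \<longlonglongrightarrow> 1)"

definition perturb_ball :: "nat \<Rightarrow> real mat \<Rightarrow> real \<Rightarrow> real mat set" where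
  "perturb_ball n P \<alpha> = {Q \<in> ergodic_mats n.
     Max ((\<lambda>i. tv_dist n (unit_vec n i \<^sub>v* P) (unit_vec n i \<^sub>v* Q)) ` {..<n}) \<le> \<alpha>}"

definition restart_perturb :: "nat \<Rightarrow> real mat \<Rightarrow> real \<Rightarrow> real vec \<Rightarrow> real mat" where
  "restart_perturb n P \<alpha> \<sigma> =
     (1 - \<alpha>) \<cdot>\<^sub>m P + \<alpha> \<cdot>\<^sub>m (mat_of_cols n [vec n (\<lambda>_. 1)] * mat_of_rows n [\<sigma>])"

end

theory Submission
  imports Defs "HOL-Library.Indicator_Function" "Jordan_Normal_Form.Char_Poly"
begin

text \<open>
  Upper bounds: \<open>P\<close> and a perturbation within \<open>\<alpha>\<close> of it can be coupled for \<open>t\<close> steps with probability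
  at least \<open>(1 - \<alpha>) ^ t\<close>, so the stationary distributions are at distance at most
  \<open>mix_dist n P t + 1 - (1 - \<alpha>) ^ t\<close>; take \<open>t = t_mix n P \<delta>\<close>. By cutoff, \<open>\<alpha> * t\<close> tends to \<open>c\<close> for
  every \<open>\<delta>\<close>, and laziness forces \<open>t\<close> to infinity, hence \<open>\<alpha>\<close> to \<open>0\<close> if \<open>c\<close> is finite.

  Lower bounds: restart at a state \<open>i\<close> from which some set \<open>A\<close> with \<open>\<pi> A > 1 - \<delta>\<close> has probability
  less than \<open>\<delta>\<close> at time \<open>T = t_mix n P (1 - \<delta>) - 1\<close>. Starr's maximal inequality for reversible chains
  yields a function \<open>h \<in> [0, 1]\<close> with \<open>\<pi> h \<ge> 1 - 3 * sqrt \<delta>\<close> and \<open>h \<le> P ^ s 1\<^sub>A\<close> for all \<open>s \<le> T\<close>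
  simultaneously. Then \<open>(P ^ k h) i \<le> (P ^ T 1\<^sub>A) i \<le> \<delta>\<close> for all \<open>k \<le> T\<close>, so the perturbed stationary
  distribution gives \<open>h\<close> a mean of at most \<open>\<delta> + (1 - \<alpha>) ^ (T + 1)\<close>.
\<close>

section \<open>Markov kernels acting on functions\<close>

definition mean :: "nat \<Rightarrow> real vec \<Rightarrow> (nat \<Rightarrow> real) \<Rightarrow> real" where
  "mean n \<mu> f = (\<Sum>i<n. \<mu> $ i * f i)"

text \<open>Functions on \<open>nat\<close> stand for column vectors. Only their values below
  \<open>n\<close> enter, and at \<open>i \<ge> n\<close> the result is an out-of-range matrix
  access, so pointwise comparisons below are restricted to arguments below \<open>n\<close>.\<close>

definition kernel_op :: "nat \<Rightarrow> real mat \<Rightarrow> (nat \<Rightarrow> real) \<Rightarrow> nat \<Rightarrow> real" where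
  "kernel_op n A f = (\<lambda>i. \<Sum>j<n. A $$ (i, j) * f j)"

section \<open>Entries of stochastic matrices and of their powers\<close>

lemma transition_mats_iff:
  "A \<in> transition_mats n \<longleftrightarrow> A \<in> carrier_mat n n \<and>
     (\<forall>i<n. \<forall>j<n. 0 \<le> A $$ (i, j)) \<and> (\<forall>i<n. (\<Sum>j<n. A $$ (i, j)) = 1)"
  unfolding transition_mats_def prob_vecs_def by auto

lemma transition_matsD:
  assumes "A \<in> transition_mats n"
  shows "A \<in> carrier_mat n n"
    and "i < n \<Longrightarrow> j < n \<Longrightarrow> 0 \<le> A $$ (i, j)"
    and "i < n \<Longrightarrow> (\<Sum>j<n. A $$ (i, j)) = 1"
  using assms unfolding transition_mats_iff by auto

lemma prob_vecsD:
  assumes "\<mu> \<in> prob_vecs n"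
  shows "\<mu> \<in> carrier_vec n" "i < n \<Longrightarrow> 0 \<le> \<mu> $ i" "(\<Sum>i<n. \<mu> $ i) = 1"
  using assms unfolding prob_vecs_def by auto

lemma vec_mult_mat_carrier:
  "A \<in> carrier_mat n n \<Longrightarrow> v \<^sub>v* A \<in> carrier_vec n"
  unfolding vec_mult_mat_def by (simp add: carrier_vecI)

lemma vec_mult_mat_index:
  assumes "A \<in> carrier_mat n n" "v \<in> carrier_vec n" "j < n"
  shows "(v \<^sub>v* A) $ j = (\<Sum>i<n. v $ i * A $$ (i, j))"
  using assms unfolding vec_mult_mat_def
  by (auto simp: scalar_prod_def lessThan_atLeast0 mult.commute intro!: sum.cong)

lemma unit_vec_mult_mat_index:
  assumes "A \<in> carrier_mat n n" "i < n" "j < n"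
  shows "(unit_vec n i \<^sub>v* A) $ j = A $$ (i, j)"
proof -
  have "(unit_vec n i \<^sub>v* A) $ j = (\<Sum>k<n. unit_vec n i $ k * A $$ (k, j))"
    using assms by (intro vec_mult_mat_index) auto
  also have "\<dots> = (\<Sum>k<n. if k = i then A $$ (k, j) else 0)"
    using assms by (intro sum.cong) auto
  also have "\<dots> = A $$ (i, j)"
    using assms by simp
  finally show ?thesis .
qed

lemma pow_mat_Suc_index:
  fixes A :: "real mat"
  assumes "A \<in> carrier_mat n n" "i < n" "j < n"
  shows "(A ^\<^sub>m Suc t) $$ (i, j) = (\<Sum>k<n. (A ^\<^sub>m t) $$ (i, k) * A $$ (k, j))"
  using assms by (auto simp: scalar_prod_def lessThan_atLeast0)

lemma transition_mats_pow:
  assumes "A \<in> transition_mats n"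
  shows "A ^\<^sub>m t \<in> transition_mats n"
proof (induction t)
  case 0
  then show ?case using transition_matsD(1)[OF assms]
    by (auto simp: transition_mats_iff)
next
  case (Suc t)
  note A = transition_matsD[OF assms] and B = transition_matsD[OF Suc]
  have "(\<Sum>j<n. (A ^\<^sub>m Suc t) $$ (i, j)) = 1" if "i < n" for i
  proof -
    have "(\<Sum>j<n. (A ^\<^sub>m Suc t) $$ (i, j))
        = (\<Sum>j<n. \<Sum>k<n. (A ^\<^sub>m t) $$ (i, k) * A $$ (k, j))"
      using A(1) that by (intro sum.cong refl pow_mat_Suc_index) auto
    also have "\<dots> = (\<Sum>k<n. (A ^\<^sub>m t) $$ (i, k) * (\<Sum>j<n. A $$ (k, j)))"
      by (subst sum.swap) (simp add: sum_distrib_left)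
    also have "\<dots> = (\<Sum>k<n. (A ^\<^sub>m t) $$ (i, k))"
      by (intro sum.cong) (auto simp: A(3))
    finally show ?thesis using B(3) that by simp
  qed
  moreover have "0 \<le> (A ^\<^sub>m Suc t) $$ (i, j)" if "i < n" "j < n" for i j
    using A B that by (subst pow_mat_Suc_index) (auto intro!: sum_nonneg)
  ultimately show ?case using A(1) unfolding transition_mats_iff
    by (auto simp del: pow_mat.simps intro: pow_carrier_mat)
qed

lemma kernel_op_pow:
  assumes "A \<in> carrier_mat n n" "i < n"
  shows "(kernel_op n A ^^ t) f i = (\<Sum>j<n. (A ^\<^sub>m t) $$ (i, j) * f j)"
  using assms
proof (induction t arbitrary: f)
  case 0
  have "(\<Sum>j<n. (A ^\<^sub>m 0) $$ (i, j) * f j) = (\<Sum>j<n. if i = j then f j else 0)"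
    using 0 by (intro sum.cong) auto
  then show ?case using 0 by simp
next
  case (Suc t)
  \<comment> \<open>The innermost factor is peeled off because \<open>A ^\<^sub>m Suc t\<close> is
    \<open>A ^\<^sub>m t * A\<close>; this changes the function, hence the induction for arbitrary
    \<open>f\<close>.\<close>
  have "(kernel_op n A ^^ Suc t) f i = (kernel_op n A ^^ t) (kernel_op n A f) i"
    by (simp add: funpow_swap1)
  also have "\<dots> = (\<Sum>k<n. \<Sum>j<n. (A ^\<^sub>m t) $$ (i, k) * A $$ (k, j) * f j)"
    unfolding Suc.IH[OF Suc.prems] by (simp add: kernel_op_def sum_distrib_left mult.assoc)
  also have "\<dots> = (\<Sum>j<n. \<Sum>k<n. (A ^\<^sub>m t) $$ (i, k) * A $$ (k, j) * f j)"
    by (rule sum.swap)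
  also have "\<dots> = (\<Sum>j<n. (A ^\<^sub>m Suc t) $$ (i, j) * f j)"
    using Suc.prems
    by (intro sum.cong refl) (simp add: pow_mat_Suc_index sum_distrib_right del: pow_mat.simps)
  finally show ?case .
qed

lemma mean_unit_vec_pow:
  assumes "A \<in> carrier_mat n n" "i < n"
  shows "mean n (unit_vec n i \<^sub>v* (A ^\<^sub>m t)) f = (kernel_op n A ^^ t) f i"
  unfolding mean_def kernel_op_pow[OF assms]
  using assms by (intro sum.cong) (auto simp: unit_vec_mult_mat_index)

lemma mean_unit_vec:
  assumes "A \<in> carrier_mat n n" "i < n"
  shows "mean n (unit_vec n i \<^sub>v* A) f = kernel_op n A f i"
  unfolding mean_def kernel_op_def
  using assms by (intro sum.cong) (auto simp: unit_vec_mult_mat_index)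

lemma mean_vec_mult_mat:
  assumes "A \<in> carrier_mat n n" "\<mu> \<in> carrier_vec n"
  shows "mean n (\<mu> \<^sub>v* A) f = mean n \<mu> (kernel_op n A f)"
proof -
  have "mean n (\<mu> \<^sub>v* A) f = (\<Sum>j<n. \<Sum>i<n. \<mu> $ i * A $$ (i, j) * f j)"
    unfolding mean_def using assms
    by (intro sum.cong refl) (simp add: vec_mult_mat_index sum_distrib_right)
  also have "\<dots> = (\<Sum>i<n. \<Sum>j<n. \<mu> $ i * A $$ (i, j) * f j)"
    by (rule sum.swap)
  finally show ?thesis by (simp add: mean_def kernel_op_def sum_distrib_left mult.assoc)
qed

section \<open>Linearity, monotonicity and invariance of means and kernel powers\<close>

lemma mean_add: "mean n \<mu> (\<lambda>i. f i + g i) = mean n \<mu> f + mean n \<mu> g"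
  by (simp add: mean_def algebra_simps sum.distrib)

lemma mean_diff: "mean n \<mu> (\<lambda>i. f i - g i) = mean n \<mu> f - mean n \<mu> g"
  by (simp add: mean_def algebra_simps sum_subtractf)

lemma mean_cmult: "mean n \<mu> (\<lambda>i. a * f i) = a * mean n \<mu> f"
  by (simp add: mean_def sum_distrib_left mult.left_commute)

lemma mean_const: "\<mu> \<in> prob_vecs n \<Longrightarrow> mean n \<mu> (\<lambda>i. a) = a"
  by (simp add: mean_def prob_vecs_def flip: sum_distrib_right)

lemma mean_mono:
  assumes "\<mu> \<in> prob_vecs n" "\<And>i. i < n \<Longrightarrow> f i \<le> g i"
  shows "mean n \<mu> f \<le> mean n \<mu> g"
  unfolding mean_def using assms by (auto intro!: sum_mono mult_left_mono simp: prob_vecs_def)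

lemma mean_cong:
  "(\<And>i. i < n \<Longrightarrow> f i = g i) \<Longrightarrow> mean n \<mu> f = mean n \<mu> g"
  unfolding mean_def by auto

lemma mean_stationary_pow:
  assumes "A \<in> carrier_mat n n" "\<mu> \<in> carrier_vec n" "\<mu> \<^sub>v* A = \<mu>"
  shows "mean n \<mu> ((kernel_op n A ^^ t) f) = mean n \<mu> f"
proof (induction t)
  case (Suc t)
  then show ?case using mean_vec_mult_mat[OF assms(1,2)] assms(3) by simp
qed simp

lemma kernel_op_mono:
  assumes "A \<in> transition_mats n" "\<And>j. j < n \<Longrightarrow> f j \<le> g j" "i < n"
  shows "kernel_op n A f i \<le> kernel_op n A g i"
  unfolding kernel_op_def using assms
  by (auto intro!: sum_mono mult_left_mono simp: transition_matsD)

lemma kernel_op_add: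
  "kernel_op n A (\<lambda>i. f i + g i) = (\<lambda>i. kernel_op n A f i + kernel_op n A g i)"
  by (simp add: kernel_op_def algebra_simps sum.distrib)

lemma kernel_op_const:
  "A \<in> transition_mats n \<Longrightarrow> i < n \<Longrightarrow> kernel_op n A (\<lambda>i. a) i = a"
  by (simp add: kernel_op_def transition_matsD flip: sum_distrib_right)

lemma kernel_op_cong:
  "(\<And>j. j < n \<Longrightarrow> f j = g j) \<Longrightarrow> kernel_op n A f i = kernel_op n A g i"
  unfolding kernel_op_def by auto

lemma kernel_op_pow_mono:
  assumes "A \<in> transition_mats n" "\<And>j. j < n \<Longrightarrow> f j \<le> g j" "i < n"
  shows "(kernel_op n A ^^ t) f i \<le> (kernel_op n A ^^ t) g i"
  using assms(3) by (induction t arbitrary: i) (auto intro: assms(2) kernel_op_mono[OF assms(1)])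

lemma kernel_op_pow_const:
  assumes "A \<in> transition_mats n" "i < n"
  shows "(kernel_op n A ^^ t) (\<lambda>i. a) i = a"
  using assms(2)
proof (induction t arbitrary: i)
  case (Suc t)
  have "(kernel_op n A ^^ Suc t) (\<lambda>i. a) i = kernel_op n A (\<lambda>i. a) i"
    using Suc.IH by (auto intro: kernel_op_cong)
  then show ?case using kernel_op_const[OF assms(1) Suc.prems] by simp
qed simp

lemma kernel_op_pow_add:
  "(kernel_op n A ^^ t) (\<lambda>i. f i + g i) =
     (\<lambda>i. (kernel_op n A ^^ t) f i + (kernel_op n A ^^ t) g i)"
  by (induction t) (auto simp: kernel_op_add)

lemma kernel_op_pow_ge:
  assumes "A \<in> transition_mats n" "\<And>j. j < n \<Longrightarrow> a \<le> f j" "i < n"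
  shows "a \<le> (kernel_op n A ^^ t) f i"
  using kernel_op_pow_mono[OF assms(1), of "\<lambda>_. a" f i t] kernel_op_pow_const[OF assms(1,3)] assms
  by simp

lemma kernel_op_pow_le:
  assumes "A \<in> transition_mats n" "\<And>j. j < n \<Longrightarrow> f j \<le> a" "i < n"
  shows "(kernel_op n A ^^ t) f i \<le> a"
  using kernel_op_pow_mono[OF assms(1), of f "\<lambda>_. a" i t] kernel_op_pow_const[OF assms(1,3)] assms
  by simp

section \<open>Total variation distance\<close>

lemma tv_dist_ge:
  assumes "A \<subseteq> {..<n}"
  shows "\<bar>(\<Sum>i\<in>A. \<mu> $ i) - (\<Sum>i\<in>A. \<nu> $ i)\<bar> \<le> tv_dist n \<mu> \<nu>"
  unfolding tv_dist_def using assms by (intro Max_ge) auto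

lemma tv_dist_nonneg: "0 \<le> tv_dist n \<mu> \<nu>"
  using tv_dist_ge[of "{}" n \<mu> \<nu>] by simp

text \<open>Among all weights in \<open>[0, 1]\<close>, the indicator of the set where
  \<open>\<mu>\<close> exceeds \<open>\<nu>\<close> maximises the weighted sum of
  \<open>\<mu> - \<nu>\<close>.\<close>

lemma mean_diff_le_tv_dist:
  assumes "\<And>i. i < n \<Longrightarrow> 0 \<le> f i \<and> f i \<le> 1"
  shows "mean n \<mu> f - mean n \<nu> f \<le> tv_dist n \<mu> \<nu>"
proof -
  let ?A = "{i\<in>{..<n}. \<nu> $ i < \<mu> $ i}"
  have "mean n \<mu> f - mean n \<nu> f = (\<Sum>i<n. (\<mu> $ i - \<nu> $ i) * f i)"
    by (simp add: mean_def algebra_simps sum_subtractf)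
  also have "\<dots> \<le> (\<Sum>i<n. if \<nu> $ i < \<mu> $ i then \<mu> $ i - \<nu> $ i else 0)"
    using assms by (intro sum_mono) (auto intro: mult_left_le simp: mult_nonpos_nonneg)
  also have "\<dots> = (\<Sum>i\<in>?A. \<mu> $ i - \<nu> $ i)"
    by (rule sum.inter_filter[symmetric]) simp
  also have "\<dots> \<le> tv_dist n \<mu> \<nu>"
    unfolding sum_subtractf by (rule order_trans[OF abs_ge_self tv_dist_ge]) auto
  finally show ?thesis .
qed

lemma mean_indicator:
  assumes "A \<subseteq> {..<n}"
  shows "mean n \<mu> (indicator A) = (\<Sum>i\<in>A. \<mu> $ i)"
proof -
  have "mean n \<mu> (indicator A) = (\<Sum>i<n. if i \<in> A then \<mu> $ i else 0)"
    unfolding mean_def by (intro sum.cong) (auto simp: indicator_def)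
  also have "\<dots> = (\<Sum>i\<in>A. \<mu> $ i)"
    using sum.inter_restrict[of "{..<n}" "\<lambda>i. \<mu> $ i" A] assms by (simp add: Int_absorb1)
  finally show ?thesis .
qed

lemma tv_dist_attained:
  assumes "\<mu> \<in> prob_vecs n" "\<nu> \<in> prob_vecs n"
  obtains A where "A \<subseteq> {..<n}" "tv_dist n \<mu> \<nu> = mean n \<mu> (indicator A) - mean n \<nu> (indicator A)"
proof -
  have "tv_dist n \<mu> \<nu> \<in> (\<lambda>A. \<bar>(\<Sum>i\<in>A. \<mu> $ i) - (\<Sum>i\<in>A. \<nu> $ i)\<bar>) ` Pow {..<n}"
    unfolding tv_dist_def by (rule Max_in) auto
  then obtain A where A: "A \<subseteq> {..<n}"
    and eq: "tv_dist n \<mu> \<nu> = \<bar>mean n \<mu> (indicator A) - mean n \<nu> (indicator A)\<bar>"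
    by (auto simp: mean_indicator)
  show ?thesis
  proof (cases "0 \<le> mean n \<mu> (indicator A) - mean n \<nu> (indicator A)")
    case True
    with A eq that show ?thesis by auto
  next
    case False
    have compl: "mean n \<kappa> (indicator ({..<n} - A)) = 1 - mean n \<kappa> (indicator A)"
      if "\<kappa> \<in> prob_vecs n" for \<kappa>
    proof -
      have "mean n \<kappa> (indicator ({..<n} - A)) = mean n \<kappa> (\<lambda>i. 1 - indicator A i)"
        by (intro mean_cong) (auto simp: indicator_def)
      then show ?thesis using that by (simp add: mean_diff mean_const)
    qed
    show ?thesis
      using that[of "{..<n} - A"] False eq assms by (auto simp: compl)
  qed
qed

lemma tv_dist_le:
  assumes "\<mu> \<in> prob_vecs n" "\<nu> \<in> prob_vecs n"
    and "\<And>A. A \<subseteq> {..<n} \<Longrightarrow> mean n \<mu> (indicator A) - mean n \<nu> (indicator A) \<le> x"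
  shows "tv_dist n \<mu> \<nu> \<le> x"
  using tv_dist_attained[OF assms(1,2)] assms(3) by metis

lemma tv_dist_commute: "tv_dist n \<mu> \<nu> = tv_dist n \<nu> \<mu>"
  unfolding tv_dist_def by (simp add: abs_minus_commute)

lemma tv_dist_le_sum:
  "tv_dist n \<mu> \<nu> \<le> (\<Sum>i<n. \<bar>\<mu> $ i - \<nu> $ i\<bar>)"
proof -
  have "\<bar>(\<Sum>i\<in>A. \<mu> $ i) - (\<Sum>i\<in>A. \<nu> $ i)\<bar> \<le> (\<Sum>i<n. \<bar>\<mu> $ i - \<nu> $ i\<bar>)"
    if "A \<subseteq> {..<n}" for A
  proof -
    have "\<bar>(\<Sum>i\<in>A. \<mu> $ i) - (\<Sum>i\<in>A. \<nu> $ i)\<bar> \<le> (\<Sum>i\<in>A. \<bar>\<mu> $ i - \<nu> $ i\<bar>)"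
      by (simp add: sum_subtractf[symmetric] sum_abs)
    also have "\<dots> \<le> (\<Sum>i<n. \<bar>\<mu> $ i - \<nu> $ i\<bar>)"
      using that by (intro sum_mono2) auto
    finally show ?thesis .
  qed
  then show ?thesis unfolding tv_dist_def by (subst Max_le_iff) auto
qed

lemma tv_dist_le_1:
  assumes "\<mu> \<in> prob_vecs n" "\<nu> \<in> prob_vecs n"
  shows "tv_dist n \<mu> \<nu> \<le> 1"
proof (rule tv_dist_le[OF assms])
  fix A :: "nat set"
  have "mean n \<mu> (indicator A) \<le> mean n \<mu> (\<lambda>_. 1)" "mean n \<nu> (\<lambda>_. 0) \<le> mean n \<nu> (indicator A)"
    by (intro mean_mono assms; simp add: indicator_def)+
  then show "mean n \<mu> (indicator A) - mean n \<nu> (indicator A) \<le> 1"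
    using assms by (simp add: mean_const)
qed

section \<open>Stationary distributions\<close>

text \<open>The all-ones vector is a right eigenvector for 1, and a matrix has the same
  characteristic polynomial as its transpose, so a left eigenvector \<open>v\<close> exists. The
  triangle inequality bounds \<open>\<bar>v\<bar>\<close> entrywise by
  \<open>\<bar>v\<bar> A\<close>. Both have the same total, so they agree, and normalising
  \<open>\<bar>v\<bar>\<close> gives the distribution.\<close>

lemma stationary_dist_exists:
  assumes "A \<in> transition_mats n" "1 \<le> n"
  obtains \<mu> where "\<mu> \<in> prob_vecs n" "\<mu> \<^sub>v* A = \<mu>"
proof -
  note A = transition_matsD[OF assms(1)]
  define e :: "real vec" where "e = vec n (\<lambda>_. 1)"
  have "A *\<^sub>v e = 1 \<cdot>\<^sub>v e"
    using A by (intro eq_vecI) (auto simp: e_def scalar_prod_def lessThan_atLeast0)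
  moreover have "e \<noteq> 0\<^sub>v n"
    using assms(2) by (metis e_def index_vec index_zero_vec(1) less_eq_Suc_le One_nat_def zero_neq_one)
  ultimately have "eigenvalue A 1"
    using A(1) unfolding eigenvalue_def eigenvector_def by (intro exI[of _ e]) (auto simp: e_def)
  then have "eigenvalue (transpose_mat A) 1"
    using A(1) by (simp add: eigenvalue_root_char_poly[of _ n])
  then obtain v where v: "v \<in> carrier_vec n" "v \<noteq> 0\<^sub>v n" "v \<^sub>v* A = v"
    using A(1) unfolding eigenvalue_def eigenvector_def vec_mult_mat_def by auto
  define S where "S = (\<Sum>i<n. \<bar>v $ i\<bar>)"
  define w where "w j = (\<Sum>i<n. \<bar>v $ i\<bar> * A $$ (i, j))" for j
  have v_eq: "v $ j = (\<Sum>i<n. v $ i * A $$ (i, j))" if "j < n" for j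
    using vec_mult_mat_index[OF A(1) v(1) that] v(3) by simp
  have le: "\<bar>v $ j\<bar> \<le> w j" if "j < n" for j
  proof -
    have "\<bar>v $ j\<bar> \<le> (\<Sum>i<n. \<bar>v $ i * A $$ (i, j)\<bar>)"
      by (subst v_eq[OF that]) (rule sum_abs)
    also have "\<dots> = w j"
      unfolding w_def using A(2) that by (intro sum.cong) (auto simp: abs_mult)
    finally show ?thesis .
  qed
  have "(\<Sum>j<n. w j) = (\<Sum>i<n. \<Sum>j<n. \<bar>v $ i\<bar> * A $$ (i, j))"
    unfolding w_def by (rule sum.swap)
  also have "\<dots> = (\<Sum>i<n. \<bar>v $ i\<bar> * (\<Sum>j<n. A $$ (i, j)))"
    by (simp add: sum_distrib_left)
  also have "\<dots> = S"
    unfolding S_def by (intro sum.cong) (auto simp: A(3))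
  finally have "(\<Sum>j<n. w j - \<bar>v $ j\<bar>) = 0"
    by (simp add: sum_subtractf S_def)
  then have w: "w j = \<bar>v $ j\<bar>" if "j < n" for j
    using le that by (subst (asm) sum_nonneg_eq_0_iff) auto
  obtain k where "k < n" "v $ k \<noteq> 0"
    using v(1,2) by (metis carrier_vecD eq_vecI index_zero_vec)
  then have "0 < S"
    unfolding S_def by (intro sum_pos2[of _ k]) auto
  define \<mu> where "\<mu> = vec n (\<lambda>i. \<bar>v $ i\<bar> / S)"
  have "\<mu> \<in> prob_vecs n"
    using \<open>0 < S\<close> by (auto simp: prob_vecs_def \<mu>_def S_def simp flip: sum_divide_distrib)
  moreover have "\<mu> \<^sub>v* A = \<mu>"
  proof (rule eq_vecI)
    show "dim_vec (\<mu> \<^sub>v* A) = dim_vec \<mu>"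
      using vec_mult_mat_carrier[OF A(1), of \<mu>] by (simp add: \<mu>_def)
    fix j assume "j < dim_vec \<mu>"
    then have "j < n" by (simp add: \<mu>_def)
    then have "(\<mu> \<^sub>v* A) $ j = (\<Sum>i<n. \<mu> $ i * A $$ (i, j))"
      by (intro vec_mult_mat_index A) (auto simp: \<mu>_def)
    also have "\<dots> = w j / S"
      unfolding w_def by (auto simp: \<mu>_def sum_divide_distrib intro: sum.cong)
    finally show "(\<mu> \<^sub>v* A) $ j = \<mu> $ j"
      using \<open>j < n\<close> by (simp add: \<mu>_def w)
  qed
  ultimately show ?thesis using that by blast
qed

section \<open>Contraction of positive kernels and uniqueness of the stationary distribution\<close>

text \<open>Subtracting \<open>\<beta>\<close> from every entry does not change the action on vectors of total mass zero
  and leaves a nonnegative kernel with row sums \<open>1 - n * \<beta>\<close>.\<close>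

lemma doeblin_contraction:
  fixes s :: "nat \<Rightarrow> nat \<Rightarrow> real"
  assumes "\<And>i j. i < n \<Longrightarrow> j < n \<Longrightarrow> \<beta> \<le> s i j"
    and "\<And>i. i < n \<Longrightarrow> (\<Sum>j<n. s i j) = 1"
    and "(\<Sum>i<n. d i) = 0"
  shows "(\<Sum>j<n. \<bar>\<Sum>i<n. d i * s i j\<bar>) \<le> (1 - real n * \<beta>) * (\<Sum>i<n. \<bar>d i\<bar>)"
proof -
  have "(\<Sum>j<n. \<bar>\<Sum>i<n. d i * s i j\<bar>) \<le> (\<Sum>j<n. \<Sum>i<n. \<bar>d i\<bar> * (s i j - \<beta>))"
  proof (rule sum_mono)
    fix j assume j: "j \<in> {..<n}"
    have "(\<Sum>i<n. d i * s i j) = (\<Sum>i<n. d i * (s i j - \<beta>))"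
      using assms(3) by (simp add: algebra_simps sum_subtractf flip: sum_distrib_left)
    then have "\<bar>\<Sum>i<n. d i * s i j\<bar> \<le> (\<Sum>i<n. \<bar>d i * (s i j - \<beta>)\<bar>)"
      by simp
    also have "\<dots> = (\<Sum>i<n. \<bar>d i\<bar> * (s i j - \<beta>))"
      using assms(1) j by (intro sum.cong) (auto simp: abs_mult)
    finally show "\<bar>\<Sum>i<n. d i * s i j\<bar> \<le> \<dots>" .
  qed
  also have "\<dots> = (\<Sum>i<n. \<bar>d i\<bar> * (\<Sum>j<n. s i j - \<beta>))"
    by (subst sum.swap) (simp add: sum_distrib_left)
  also have "\<dots> = (\<Sum>i<n. \<bar>d i\<bar> * (1 - real n * \<beta>))"
    by (intro sum.cong) (auto simp: sum_subtractf assms(2))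
  finally show ?thesis by (simp add: sum_distrib_left mult.commute)
qed

text \<open>Supplies the constant for \<open>doeblin_contraction\<close>: the smallest entry works.
  Row 0 shows that \<open>n\<close> times it is at most 1, so the contraction factor is
  nonnegative.\<close>

lemma positive_kernel_lower_bound:
  fixes s :: "nat \<Rightarrow> nat \<Rightarrow> real"
  assumes "\<And>i j. i < n \<Longrightarrow> j < n \<Longrightarrow> 0 < s i j" "1 \<le> n"
    and "\<And>i. i < n \<Longrightarrow> (\<Sum>j<n. s i j) = 1"
  obtains \<beta> where "0 < \<beta>" "real n * \<beta> \<le> 1" "\<And>i j. i < n \<Longrightarrow> j < n \<Longrightarrow> \<beta> \<le> s i j"
proof -
  let ?V = "(\<lambda>(i, j). s i j) ` ({..<n} \<times> {..<n})"
  have ne: "?V \<noteq> {}" using assms(2) by (auto simp: lessThan_empty_iff)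
  have le: "Min ?V \<le> s i j" if "i < n" "j < n" for i j
    using that by (intro Min_le) auto
  have "0 < Min ?V" using ne assms(1) by (subst Min_gr_iff) auto
  moreover have "real n * Min ?V \<le> 1"
  proof -
    have "(\<Sum>j<n. Min ?V) \<le> (\<Sum>j<n. s 0 j)" using assms(2) by (intro sum_mono le) auto
    then show ?thesis using assms(2,3) by simp
  qed
  ultimately show ?thesis using le that by blast
qed

lemma stationary_pow_index:
  assumes "A \<in> carrier_mat n n" "\<mu> \<in> carrier_vec n" "\<mu> \<^sub>v* A = \<mu>" "j < n"
  shows "(\<Sum>i<n. \<mu> $ i * (A ^\<^sub>m t) $$ (i, j)) = \<mu> $ j"
proof -
  have "(kernel_op n A ^^ t) (indicator {j}) i = (A ^\<^sub>m t) $$ (i, j)" if "i < n" for i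
    unfolding kernel_op_pow[OF assms(1) that]
    using assms(4) by (simp add: indicator_def)
  then have "(\<Sum>i<n. \<mu> $ i * (A ^\<^sub>m t) $$ (i, j)) = mean n \<mu> ((kernel_op n A ^^ t) (indicator {j}))"
    by (simp add: mean_def)
  also have "\<dots> = mean n \<mu> (indicator {j})"
    by (rule mean_stationary_pow[OF assms(1-3)])
  also have "\<dots> = \<mu> $ j"
    using assms(4) by (simp add: mean_indicator)
  finally show ?thesis .
qed

text \<open>The average \<open>s\<close> of the powers of \<open>A\<close> up to a large
  \<open>N\<close> is a strictly positive stochastic kernel that fixes both \<open>\<mu>\<close> and
  \<open>\<nu>\<close>. It shrinks their \<open>l1\<close> distance by a factor below 1, so this
  distance is zero.\<close>

lemma stationary_dist_unique:
  assumes "A \<in> transition_mats n" "irreducible_mat n A" "1 \<le> n"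
    and "\<mu> \<in> prob_vecs n" "\<mu> \<^sub>v* A = \<mu>" "\<nu> \<in> prob_vecs n" "\<nu> \<^sub>v* A = \<nu>"
  shows "\<mu> = \<nu>"
proof -
  note A = transition_matsD[OF assms(1)] and At = transition_matsD[OF transition_mats_pow[OF assms(1)]]
  obtain T where T: "\<And>i j. i < n \<Longrightarrow> j < n \<Longrightarrow> 0 < (A ^\<^sub>m T i j) $$ (i, j)"
    using assms(2) unfolding irreducible_mat_def by metis
  define N where "N = Max ((\<lambda>(i, j). T i j) ` ({..<n} \<times> {..<n}))"
  have N: "T i j \<le> N" if "i < n" "j < n" for i j
    unfolding N_def using that by (intro Max_ge) auto
  define s where "s i j = (\<Sum>t\<le>N. (A ^\<^sub>m t) $$ (i, j)) / real (Suc N)" for i j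
  have pos: "0 < s i j" if "i < n" "j < n" for i j
  proof -
    have "0 < (\<Sum>t\<le>N. (A ^\<^sub>m t) $$ (i, j))"
      using T[OF that] N[OF that] At(2)[OF that] by (intro sum_pos2[of _ "T i j"]) auto
    then show ?thesis by (simp add: s_def)
  qed
  have rows: "(\<Sum>j<n. s i j) = 1" if "i < n" for i
  proof -
    have "(\<Sum>j<n. s i j) = (\<Sum>t\<le>N. \<Sum>j<n. (A ^\<^sub>m t) $$ (i, j)) / real (Suc N)"
      unfolding s_def sum_divide_distrib[symmetric] by (subst sum.swap) simp
    then show ?thesis using At that by simp
  qed
  have fixed: "(\<Sum>i<n. \<kappa> $ i * s i j) = \<kappa> $ j"
    if "j < n" "\<kappa> \<in> prob_vecs n" "\<kappa> \<^sub>v* A = \<kappa>" for \<kappa> j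
  proof -
    have "(\<Sum>i<n. \<kappa> $ i * s i j) = (\<Sum>t\<le>N. \<Sum>i<n. \<kappa> $ i * (A ^\<^sub>m t) $$ (i, j)) / real (Suc N)"
      unfolding s_def sum_divide_distrib[symmetric] times_divide_eq_right sum_distrib_left
      by (subst sum.swap) simp
    also have "\<dots> = \<kappa> $ j"
      using stationary_pow_index[OF A(1) prob_vecsD(1)[OF that(2)] that(3,1)] by simp
    finally show ?thesis .
  qed
  obtain \<beta> where \<beta>: "0 < \<beta>" "\<And>i j. i < n \<Longrightarrow> j < n \<Longrightarrow> \<beta> \<le> s i j"
    using positive_kernel_lower_bound[of n s] pos rows assms(3) by metis
  define D where "D = (\<Sum>i<n. \<bar>\<mu> $ i - \<nu> $ i\<bar>)"
  have "D = (\<Sum>j<n. \<bar>\<Sum>i<n. (\<mu> $ i - \<nu> $ i) * s i j\<bar>)"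
    unfolding D_def using fixed assms(4-7)
    by (intro sum.cong) (auto simp: left_diff_distrib sum_subtractf)
  also have "\<dots> \<le> (1 - real n * \<beta>) * D"
    unfolding D_def using assms(4,6)
    by (intro doeblin_contraction \<beta> rows) (auto simp: sum_subtractf prob_vecs_def)
  finally have "real n * \<beta> * D \<le> 0" by (simp add: algebra_simps)
  then have "D \<le> 0" using \<beta>(1) assms(3) by (simp add: mult_le_0_iff)
  then have "D = 0" unfolding D_def by (intro antisym sum_nonneg) auto
  then have "\<mu> $ i = \<nu> $ i" if "i < n" for i
    using that unfolding D_def by (subst (asm) sum_nonneg_eq_0_iff) auto
  then show ?thesis using assms(4,6) by (intro eq_vecI) (auto simp: prob_vecs_def)
qed

lemma stationary_dist_props:
  assumes "A \<in> ergodic_mats n" "1 \<le> n"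
  shows "stationary_dist n A \<in> prob_vecs n" "stationary_dist n A \<^sub>v* A = stationary_dist n A"
proof -
  have A: "A \<in> transition_mats n" "irreducible_mat n A"
    using assms(1) by (auto simp: ergodic_mats_def)
  obtain \<mu> where \<mu>: "\<mu> \<in> prob_vecs n" "\<mu> \<^sub>v* A = \<mu>"
    using stationary_dist_exists[OF A(1) assms(2)] .
  have "\<exists>!\<mu>. \<mu> \<in> prob_vecs n \<and> \<mu> \<^sub>v* A = \<mu>"
    using \<mu> stationary_dist_unique[OF A assms(2) _ _ \<mu>] by blast
  from theI'[OF this]
  have "stationary_dist n A \<in> prob_vecs n \<and> stationary_dist n A \<^sub>v* A = stationary_dist n A"
    unfolding stationary_dist_def .
  then show "stationary_dist n A \<in> prob_vecs n" "stationary_dist n A \<^sub>v* A = stationary_dist n A"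
    by auto
qed

section \<open>Mixing times of lazy chains\<close>

text \<open>Having reached \<open>j\<close> at time \<open>t\<close>, a lazy chain stays there for
  \<open>k\<close> more steps with probability at least \<open>1 / 2 ^ k\<close>.\<close>

lemma lazy_pow_index_ge:
  assumes "A \<in> transition_mats n" "lazy_mat n A" "i < n" "j < n"
  shows "(A ^\<^sub>m t) $$ (i, j) / 2 ^ k \<le> (A ^\<^sub>m (t + k)) $$ (i, j)"
proof (induction k)
  case (Suc k)
  note A = transition_matsD[OF assms(1)] and At = transition_matsD[OF transition_mats_pow[OF assms(1)]]
  have "(A ^\<^sub>m t) $$ (i, j) / 2 ^ Suc k \<le> (A ^\<^sub>m (t + k)) $$ (i, j) * (1 / 2)"
    using Suc by simp
  also have "\<dots> \<le> (A ^\<^sub>m (t + k)) $$ (i, j) * A $$ (j, j)"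
    using assms(2-4) At by (intro mult_left_mono) (auto simp: lazy_mat_def)
  also have "\<dots> \<le> (\<Sum>l<n. (A ^\<^sub>m (t + k)) $$ (i, l) * A $$ (l, j))"
    using assms(3,4) A At
    by (intro member_le_sum[of j _ "\<lambda>l. (A ^\<^sub>m (t + k)) $$ (i, l) * A $$ (l, j)"]) auto
  also have "\<dots> = (A ^\<^sub>m Suc (t + k)) $$ (i, j)"
    by (rule pow_mat_Suc_index[OF A(1) assms(3,4), symmetric])
  finally show ?case by simp
qed simp

lemma mix_dist_ge:
  assumes "i < n"
  shows "tv_dist n (unit_vec n i \<^sub>v* (A ^\<^sub>m t)) (stationary_dist n A) \<le> mix_dist n A t"
  unfolding mix_dist_def using assms by (intro Max_ge) auto

lemma mix_dist_attained:
  assumes "1 \<le> n"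
  obtains i where "i < n"
    "mix_dist n A t = tv_dist n (unit_vec n i \<^sub>v* (A ^\<^sub>m t)) (stationary_dist n A)"
proof -
  have "mix_dist n A t \<in> (\<lambda>i. tv_dist n (unit_vec n i \<^sub>v* (A ^\<^sub>m t)) (stationary_dist n A)) ` {..<n}"
    unfolding mix_dist_def using assms by (intro Max_in) (auto simp: lessThan_empty_iff)
  then show ?thesis using that by auto
qed

text \<open>Some state has stationary mass at most \<open>1 / n\<close>, and a lazy chain started
  there is still there at time \<open>t\<close> with probability at least \<open>1 / 2 ^ t\<close>.
  That singleton is the test set.\<close>

lemma lazy_mix_dist_lower:
  assumes "A \<in> ergodic_mats n" "lazy_mat n A" "1 \<le> n"
  shows "1 / 2 ^ t - 1 / real n \<le> mix_dist n A t"
proof -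
  let ?\<pi> = "stationary_dist n A"
  have A: "A \<in> transition_mats n" using assms(1) by (auto simp: ergodic_mats_def)
  note \<pi> = prob_vecsD[OF stationary_dist_props(1)[OF assms(1,3)]]
  obtain i where i: "i < n" "?\<pi> $ i \<le> 1 / real n"
  proof (rule ccontr)
    assume "\<not> thesis"
    then have "1 / real n < ?\<pi> $ i" if "i < n" for i
      using that \<open>\<And>i. i < n \<Longrightarrow> ?\<pi> $ i \<le> 1 / real n \<Longrightarrow> thesis\<close> by (meson not_le)
    then have "(\<Sum>i<n. 1 / real n) < (\<Sum>i<n. ?\<pi> $ i)"
      using assms(3) by (intro sum_strict_mono) (auto simp: lessThan_empty_iff)
    then show False using \<pi>(3) assms(3) by simp
  qed
  have "1 / 2 ^ t \<le> (A ^\<^sub>m t) $$ (i, i)"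
    using lazy_pow_index_ge[OF A assms(2) i(1) i(1), of 0 t] transition_matsD(1)[OF A] i(1)
    by simp
  then have "1 / 2 ^ t - 1 / real n \<le> (A ^\<^sub>m t) $$ (i, i) - ?\<pi> $ i"
    using i(2) by simp
  also have "\<dots> = (\<Sum>j\<in>{i}. (unit_vec n i \<^sub>v* (A ^\<^sub>m t)) $ j) - (\<Sum>j\<in>{i}. ?\<pi> $ j)"
    using i(1) transition_matsD(1)[OF A] by (simp add: unit_vec_mult_mat_index)
  also have "\<dots> \<le> tv_dist n (unit_vec n i \<^sub>v* (A ^\<^sub>m t)) ?\<pi>"
    using i(1) by (intro order_trans[OF abs_ge_self tv_dist_ge]) auto
  also have "\<dots> \<le> mix_dist n A t" using mix_dist_ge[OF i(1)] .
  finally show ?thesis .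
qed

text \<open>Chapman-Kolmogorov equation, read off from iterates of \<open>kernel_op\<close> applied
  to the indicator of \<open>j\<close>.\<close>

lemma pow_mat_mult_add_index:
  fixes A :: "real mat"
  assumes "A \<in> carrier_mat n n" "i < n" "j < n"
  shows "(A ^\<^sub>m (s + t)) $$ (i, j) = (\<Sum>k<n. (A ^\<^sub>m s) $$ (i, k) * (A ^\<^sub>m t) $$ (k, j))"
proof -
  have single: "(kernel_op n A ^^ r) (indicator {j}) l = (A ^\<^sub>m r) $$ (l, j)" if "l < n" for l r
    unfolding kernel_op_pow[OF assms(1) that] using assms(3) by (simp add: indicator_def)
  have "(A ^\<^sub>m (s + t)) $$ (i, j) = (kernel_op n A ^^ s) ((kernel_op n A ^^ t) (indicator {j})) i"
    using single[OF assms(2), of "s + t"] by (simp add: funpow_add)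
  also have "\<dots> = (\<Sum>k<n. (A ^\<^sub>m s) $$ (i, k) * (A ^\<^sub>m t) $$ (k, j))"
    unfolding kernel_op_pow[OF assms(1,2), of s] by (intro sum.cong) (auto simp: single)
  finally show ?thesis .
qed

text \<open>Ensures that the \<open>LEAST\<close> in \<open>t_mix\<close> is attained. Laziness
  carries the positivity of \<open>A ^\<^sub>m T i j\<close> forward to a common time
  \<open>N\<close>, so \<open>A ^\<^sub>m N\<close> is strictly positive and contracts the
  \<open>l1\<close> distance to stationarity geometrically.\<close>

lemma lazy_mix_dist_small:
  assumes "A \<in> ergodic_mats n" "lazy_mat n A" "1 \<le> n" "0 < \<delta>"
  shows "\<exists>t. mix_dist n A t \<le> \<delta>"
proof -
  let ?\<pi> = "stationary_dist n A"
  have A: "A \<in> transition_mats n" "irreducible_mat n A" using assms(1) by (auto simp: ergodic_mats_def)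
  note Ac = transition_matsD[OF A(1)] and At = transition_matsD[OF transition_mats_pow[OF A(1)]]
  note st = stationary_dist_props[OF assms(1,3)] note \<pi> = prob_vecsD[OF st(1)]
  obtain T where T: "\<And>i j. i < n \<Longrightarrow> j < n \<Longrightarrow> 0 < (A ^\<^sub>m T i j) $$ (i, j)"
    using A(2) unfolding irreducible_mat_def by metis
  define N where "N = Max ((\<lambda>(i, j). T i j) ` ({..<n} \<times> {..<n}))"
  have N: "T i j \<le> N" if "i < n" "j < n" for i j
    unfolding N_def using that by (intro Max_ge) auto
  have pos: "0 < (A ^\<^sub>m N) $$ (i, j)" if "i < n" "j < n" for i j
  proof -
    have "0 < (A ^\<^sub>m T i j) $$ (i, j) / 2 ^ (N - T i j)" using T that by simp
    also have "\<dots> \<le> (A ^\<^sub>m N) $$ (i, j)"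
      using lazy_pow_index_ge[OF A(1) assms(2) that, of "T i j" "N - T i j"] N[OF that] by simp
    finally show ?thesis .
  qed
  obtain \<beta> where \<beta>: "0 < \<beta>" "real n * \<beta> \<le> 1"
      "\<And>i j. i < n \<Longrightarrow> j < n \<Longrightarrow> \<beta> \<le> (A ^\<^sub>m N) $$ (i, j)"
    using positive_kernel_lower_bound[of n "\<lambda>i j. (A ^\<^sub>m N) $$ (i, j)"] pos At assms(3) by metis
  define \<rho> where "\<rho> = 1 - real n * \<beta>"
  have \<rho>: "0 \<le> \<rho>" "\<rho> < 1" using \<beta> assms(3) by (auto simp: \<rho>_def)
  define D where "D i k = (\<Sum>j<n. \<bar>(A ^\<^sub>m (k * N)) $$ (i, j) - ?\<pi> $ j\<bar>)" for i k
  have step: "D i (Suc k) \<le> \<rho> * D i k" if i: "i < n" for i k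
  proof -
    have "D i (Suc k) = (\<Sum>j<n. \<bar>\<Sum>l<n. ((A ^\<^sub>m (k * N)) $$ (i, l) - ?\<pi> $ l) * (A ^\<^sub>m N) $$ (l, j)\<bar>)"
      unfolding D_def
    proof (intro sum.cong refl arg_cong[of _ _ abs])
      fix j assume "j \<in> {..<n}"
      then have "j < n" by simp
      have "(A ^\<^sub>m (Suc k * N)) $$ (i, j) = (\<Sum>l<n. (A ^\<^sub>m (k * N)) $$ (i, l) * (A ^\<^sub>m N) $$ (l, j))"
        using pow_mat_mult_add_index[OF Ac(1) i \<open>j < n\<close>, of "k * N" N] by (simp add: add.commute)
      then show "(A ^\<^sub>m (Suc k * N)) $$ (i, j) - ?\<pi> $ j =
          (\<Sum>l<n. ((A ^\<^sub>m (k * N)) $$ (i, l) - ?\<pi> $ l) * (A ^\<^sub>m N) $$ (l, j))"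
        using stationary_pow_index[OF Ac(1) \<pi>(1) st(2) \<open>j < n\<close>, of N]
        by (simp add: left_diff_distrib sum_subtractf)
    qed
    also have "\<dots> \<le> \<rho> * D i k"
      unfolding \<rho>_def D_def using i At \<pi>(3)
      by (intro doeblin_contraction \<beta>) (auto simp: sum_subtractf)
    finally show ?thesis .
  qed
  have D2: "D i k \<le> 2 * \<rho> ^ k" if i: "i < n" for i k
  proof (induction k)
    case 0
    have "D i 0 \<le> (\<Sum>j<n. (A ^\<^sub>m 0) $$ (i, j) + ?\<pi> $ j)"
      unfolding D_def mult_0
    proof (intro sum_mono)
      fix j assume "j \<in> {..<n}"
      then have "0 \<le> (A ^\<^sub>m 0) $$ (i, j)" "0 \<le> ?\<pi> $ j" using At(2)[OF i, of j 0] \<pi>(2) by auto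
      then show "\<bar>(A ^\<^sub>m 0) $$ (i, j) - ?\<pi> $ j\<bar> \<le> (A ^\<^sub>m 0) $$ (i, j) + ?\<pi> $ j" by linarith
    qed
    also have "\<dots> = 2" using At(3)[OF i, of 0] \<pi>(3) by (simp add: sum.distrib del: pow_mat.simps)
    finally show ?case by simp
  next
    case (Suc k)
    then show ?case using step[OF i, of k] mult_left_mono[OF Suc \<rho>(1)] by simp
  qed
  have "(\<lambda>k. 2 * \<rho> ^ k) \<longlonglongrightarrow> 2 * 0"
    using \<rho> by (intro tendsto_intros LIMSEQ_power_zero) auto
  then have "eventually (\<lambda>k. 2 * \<rho> ^ k < \<delta>) sequentially"
    using assms(4) by (intro order_tendstoD(2)) auto
  then obtain k where k: "2 * \<rho> ^ k < \<delta>" by (auto simp: eventually_sequentially)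
  have "tv_dist n (unit_vec n i \<^sub>v* (A ^\<^sub>m (k * N))) ?\<pi> \<le> \<delta>" if "i < n" for i
  proof -
    have "tv_dist n (unit_vec n i \<^sub>v* (A ^\<^sub>m (k * N))) ?\<pi> \<le> D i k"
      unfolding D_def using tv_dist_le_sum[of n "unit_vec n i \<^sub>v* (A ^\<^sub>m (k * N))" ?\<pi>] that Ac(1)
      by (simp add: unit_vec_mult_mat_index)
    then show ?thesis using D2[OF that, of k] k by simp
  qed
  then have "mix_dist n A (k * N) \<le> \<delta>"
    using mix_dist_attained[OF assms(3), of A "k * N"] by metis
  then show ?thesis by blast
qed

lemma mix_dist_t_mix:
  assumes "A \<in> ergodic_mats n" "lazy_mat n A" "1 \<le> n" "0 < \<delta>"
  shows "mix_dist n A (t_mix n A \<delta>) \<le> \<delta>"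
  unfolding t_mix_def using lazy_mix_dist_small[OF assms] by (rule LeastI_ex)

lemma t_mix_antimono:
  assumes "A \<in> ergodic_mats n" "lazy_mat n A" "1 \<le> n" "0 < \<delta>" "\<delta> \<le> \<eta>"
  shows "t_mix n A \<eta> \<le> t_mix n A \<delta>"
  using mix_dist_t_mix[OF assms(1-4)] assms(5) unfolding t_mix_def[of n A \<eta>]
  by (intro Least_le) auto

section \<open>Stability of the stationary distribution under perturbation\<close>

text \<open>One step of the coupling argument: the kernels \<open>P\<close> and \<open>Q\<close> share in each row the mass
  \<open>min (P i j) (Q i j)\<close>, which has total at least \<open>1 - \<alpha>\<close>.\<close>

lemma kernel_op_pow_diff_le:
  assumes P: "P \<in> transition_mats n" and Q: "Q \<in> transition_mats n"
    and tv: "\<And>i. i < n \<Longrightarrow> tv_dist n (unit_vec n i \<^sub>v* P) (unit_vec n i \<^sub>v* Q) \<le> \<alpha>"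
    and \<alpha>: "\<alpha> \<le> 1"
    and f: "\<And>i. i < n \<Longrightarrow> 0 \<le> f i \<and> f i \<le> 1"
    and "i < n"
  shows "(kernel_op n P ^^ t) f i - (kernel_op n Q ^^ t) f i \<le> 1 - (1 - \<alpha>) ^ t"
  using \<open>i < n\<close>
proof (induction t arbitrary: i)
  case (Suc t)
  note i = Suc.prems
  define a where "a = 1 - (1 - \<alpha>) ^ t"
  define g where "g = (kernel_op n P ^^ t) f"
  define h where "h = (kernel_op n Q ^^ t) f"
  have g: "0 \<le> g j" "g j \<le> 1" and h: "0 \<le> h j" "h j \<le> 1" if "j < n" for j
    using that f kernel_op_pow_ge[OF P, of 0 f j t] kernel_op_pow_le[OF P, of f 1 j t]
      kernel_op_pow_ge[OF Q, of 0 f j t] kernel_op_pow_le[OF Q, of f 1 j t]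
    by (auto simp: g_def h_def)
  have gh: "g j - h j \<le> a" if "j < n" for j
    using Suc.IH[OF that] by (simp add: a_def g_def h_def)
  have a: "a \<le> 1" using \<alpha> by (simp add: a_def)
  define m where "m j = min (P $$ (i, j)) (Q $$ (i, j))" for j
  define M where "M = (\<Sum>j<n. m j)"
  let ?A = "{j\<in>{..<n}. Q $$ (i, j) < P $$ (i, j)}"
  \<comment> \<open>The mass not shared is the surplus of row \<open>i\<close> of \<open>P\<close>
    over that of \<open>Q\<close>, which is their difference on the test set
    \<open>?A\<close>.\<close>
  have "1 - M = (\<Sum>j<n. P $$ (i, j) - m j)"
    using transition_matsD(3)[OF P i] by (simp add: M_def sum_subtractf)
  also have "\<dots> = (\<Sum>j<n. if Q $$ (i, j) < P $$ (i, j) then P $$ (i, j) - Q $$ (i, j) else 0)"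
    by (intro sum.cong) (auto simp: m_def min_def)
  also have "\<dots> = (\<Sum>j\<in>?A. P $$ (i, j) - Q $$ (i, j))"
    by (rule sum.inter_filter[symmetric]) simp
  also have "\<dots> = (\<Sum>j\<in>?A. (unit_vec n i \<^sub>v* P) $ j) - (\<Sum>j\<in>?A. (unit_vec n i \<^sub>v* Q) $ j)"
    unfolding sum_subtractf[symmetric]
    using i transition_matsD(1)[OF P] transition_matsD(1)[OF Q]
    by (intro sum.cong) (auto simp: unit_vec_mult_mat_index)
  also have "\<dots> \<le> \<alpha>"
    by (rule order_trans[OF order_trans[OF abs_ge_self tv_dist_ge] tv[OF i]]) auto
  finally have M: "1 - \<alpha> \<le> M" by simp
  have "(kernel_op n P ^^ Suc t) f i - (kernel_op n Q ^^ Suc t) f i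
      = (\<Sum>j<n. P $$ (i, j) * g j - Q $$ (i, j) * h j)"
    by (simp add: kernel_op_def sum_subtractf g_def h_def)
  \<comment> \<open>Split \<open>P g - Q h\<close> into
    \<open>m (g - h) + (P - m) g - (Q - m) h\<close>: the shared mass inherits the bound
    \<open>a\<close>, the surplus of \<open>P\<close> counts at most in full, and the last term can
    only help.\<close>
  also have "\<dots> \<le> (\<Sum>j<n. m j * a + (P $$ (i, j) - m j))"
  proof (rule sum_mono)
    fix j assume "j \<in> {..<n}"
    then have j: "j < n" by simp
    have "0 \<le> m j" "m j \<le> P $$ (i, j)" "m j \<le> Q $$ (i, j)"
      using transition_matsD(2)[OF P i j] transition_matsD(2)[OF Q i j] by (auto simp: m_def)
    then have "m j * (g j - h j) \<le> m j * a" "(P $$ (i, j) - m j) * g j \<le> P $$ (i, j) - m j"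
      "0 \<le> (Q $$ (i, j) - m j) * h j"
      using g[OF j] h[OF j] gh[OF j] by (auto intro: mult_left_mono mult_left_le)
    then show "P $$ (i, j) * g j - Q $$ (i, j) * h j \<le> m j * a + (P $$ (i, j) - m j)"
      by (simp add: algebra_simps)
  qed
  also have "\<dots> = 1 - M * (1 - a)"
    using transition_matsD(3)[OF P i]
    by (simp add: sum.distrib sum_subtractf M_def sum_distrib_left algebra_simps)
  also have "\<dots> \<le> 1 - (1 - \<alpha>) * (1 - a)"
    using M a by (simp add: mult_right_mono)
  also have "\<dots> = 1 - (1 - \<alpha>) ^ Suc t"
    by (simp add: a_def)
  finally show ?case .
qed simp

lemma perturb_ballD:
  assumes "Q \<in> perturb_ball n P \<alpha>"
  shows "Q \<in> ergodic_mats n"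
    and "i < n \<Longrightarrow> tv_dist n (unit_vec n i \<^sub>v* P) (unit_vec n i \<^sub>v* Q) \<le> \<alpha>"
proof -
  show "Q \<in> ergodic_mats n" using assms by (simp add: perturb_ball_def)
  assume "i < n"
  then have "tv_dist n (unit_vec n i \<^sub>v* P) (unit_vec n i \<^sub>v* Q)
      \<le> Max ((\<lambda>i. tv_dist n (unit_vec n i \<^sub>v* P) (unit_vec n i \<^sub>v* Q)) ` {..<n})"
    by (intro Max_ge) auto
  then show "tv_dist n (unit_vec n i \<^sub>v* P) (unit_vec n i \<^sub>v* Q) \<le> \<alpha>"
    using assms by (simp add: perturb_ball_def)
qed

text \<open>From every start, \<open>t\<close> steps of \<open>P\<close> come within
  \<open>mix_dist n P t\<close> of its stationary distribution, and \<open>t\<close> steps of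
  \<open>Q\<close> differ from them by at most \<open>1 - (1 - \<alpha>) ^ t\<close>. Averaging the
  start over the stationary distribution of \<open>Q\<close> leaves that distribution unchanged
  after \<open>t\<close> steps.\<close>

lemma stationary_perturb_le:
  assumes P: "P \<in> ergodic_mats n" and n: "1 \<le> n" and \<alpha>: "\<alpha> \<le> 1" and Q: "Q \<in> perturb_ball n P \<alpha>"
  shows "tv_dist n (stationary_dist n P) (stationary_dist n Q) \<le> mix_dist n P t + (1 - (1 - \<alpha>) ^ t)"
proof (rule tv_dist_le)
  let ?\<pi> = "stationary_dist n P" and ?\<rho> = "stationary_dist n Q"
  note Q' = perturb_ballD[OF Q]
  note \<rho> = stationary_dist_props[OF Q'(1) n]
  show "?\<pi> \<in> prob_vecs n" "?\<rho> \<in> prob_vecs n"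
    using stationary_dist_props(1)[OF P n] \<rho> by auto
  have Pt: "P \<in> transition_mats n" and Qt: "Q \<in> transition_mats n"
    using P Q' by (auto simp: ergodic_mats_def)
  fix A assume "A \<subseteq> {..<n}"
  let ?f = "indicator A :: nat \<Rightarrow> real"
  have f: "0 \<le> ?f i \<and> ?f i \<le> 1" for i by (simp add: indicator_def)
  have mix: "mean n ?\<pi> ?f - (kernel_op n P ^^ t) ?f i \<le> mix_dist n P t" if "i < n" for i
  proof -
    have "mean n ?\<pi> ?f - mean n (unit_vec n i \<^sub>v* (P ^\<^sub>m t)) ?f \<le> mix_dist n P t"
      using mean_diff_le_tv_dist[of n ?f ?\<pi> "unit_vec n i \<^sub>v* (P ^\<^sub>m t)"] f mix_dist_ge[OF that, of P t]
      by (simp add: tv_dist_commute)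
    then show ?thesis
      by (simp add: mean_unit_vec_pow[OF transition_matsD(1)[OF Pt] that])
  qed
  have "mean n ?\<pi> ?f - (mix_dist n P t + (1 - (1 - \<alpha>) ^ t)) \<le> (kernel_op n Q ^^ t) ?f i"
    if "i < n" for i
    using mix[OF that] kernel_op_pow_diff_le[where f="?f" and t=t, OF Pt Qt Q'(2) \<alpha> f that]
    by simp
  then have "mean n ?\<rho> (\<lambda>_. mean n ?\<pi> ?f - (mix_dist n P t + (1 - (1 - \<alpha>) ^ t)))
      \<le> mean n ?\<rho> ((kernel_op n Q ^^ t) ?f)"
    by (intro mean_mono \<rho>)
  also have "\<dots> = mean n ?\<rho> ?f"
    by (rule mean_stationary_pow[OF transition_matsD(1)[OF Qt] prob_vecsD(1)[OF \<rho>(1)] \<rho>(2)])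
  finally show "mean n ?\<pi> ?f - mean n ?\<rho> ?f \<le> mix_dist n P t + (1 - (1 - \<alpha>) ^ t)"
    using \<rho>(1) by (simp add: mean_const)
qed

section \<open>A maximal inequality for reversible chains\<close>

text \<open>Detailed balance makes \<open>kernel_op n P\<close> self-adjoint for the inner product
  weighted by \<open>\<mu>\<close>. With \<open>g\<close> constantly 1 it yields invariance of
  means.\<close>

lemma reversible_mean:
  assumes "\<And>i j. i < n \<Longrightarrow> j < n \<Longrightarrow> \<mu> $ i * P $$ (i, j) = \<mu> $ j * P $$ (j, i)"
  shows "mean n \<mu> (\<lambda>i. g i * kernel_op n P f i) = mean n \<mu> (\<lambda>i. f i * kernel_op n P g i)"
proof -
  have "mean n \<mu> (\<lambda>i. g i * kernel_op n P f i) = (\<Sum>i<n. \<Sum>j<n. (\<mu> $ i * P $$ (i, j)) * g i * f j)"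
    by (simp add: mean_def kernel_op_def sum_distrib_left mult_ac)
  also have "\<dots> = (\<Sum>i<n. \<Sum>j<n. (\<mu> $ j * P $$ (j, i)) * g i * f j)"
    using assms by (intro sum.cong) auto
  also have "\<dots> = (\<Sum>j<n. \<Sum>i<n. (\<mu> $ j * P $$ (j, i)) * g i * f j)"
    by (rule sum.swap)
  also have "\<dots> = mean n \<mu> (\<lambda>i. f i * kernel_op n P g i)"
    by (simp add: mean_def kernel_op_def sum_distrib_left mult_ac)
  finally show ?thesis .
qed

text \<open>The probability, started from \<open>X_s = x\<close>, that \<open>(kernel_op n P ^^ t) f X_t \<ge> l\<close> for some time
  \<open>t \<in> {s..<s + r}\<close>.\<close>

fun exceed_prob :: "nat \<Rightarrow> real mat \<Rightarrow> (nat \<Rightarrow> real) \<Rightarrow> real \<Rightarrow> nat \<Rightarrow> nat \<Rightarrow> nat \<Rightarrow> real" where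
  "exceed_prob n P f l 0 s = (\<lambda>x. 0)"
| "exceed_prob n P f l (Suc r) s =
     (\<lambda>x. if l \<le> (kernel_op n P ^^ s) f x then 1 else kernel_op n P (exceed_prob n P f l r (Suc s)) x)"

lemma exceed_prob_bounds:
  assumes "P \<in> transition_mats n" "x < n"
  shows "0 \<le> exceed_prob n P f l r s x \<and> exceed_prob n P f l r s x \<le> 1"
  using assms(2)
proof (induction r arbitrary: s x)
  case (Suc r)
  have "0 \<le> kernel_op n P (exceed_prob n P f l r (Suc s)) x"
    "kernel_op n P (exceed_prob n P f l r (Suc s)) x \<le> 1"
    using kernel_op_pow_ge[OF assms(1), of 0 "exceed_prob n P f l r (Suc s)" x 1]
      kernel_op_pow_le[OF assms(1), of "exceed_prob n P f l r (Suc s)" 1 x 1] Suc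
    by auto
  then show ?case by simp
qed simp

text \<open>Exceeding the level at the single time \<open>s + t\<close> is contained in exceeding it
  at some time of the window.\<close>

lemma kernel_op_pow_exceed_le:
  assumes P: "P \<in> transition_mats n"
    and "x < n" "t < r"
  shows "(kernel_op n P ^^ t) (\<lambda>y. of_bool (l \<le> (kernel_op n P ^^ (s + t)) f y)) x
     \<le> exceed_prob n P f l r s x"
  using assms(2,3)
proof (induction r arbitrary: s x t)
  case (Suc r)
  show ?case
  proof (cases "l \<le> (kernel_op n P ^^ s) f x")
    case True
    have "(kernel_op n P ^^ t) (\<lambda>y. of_bool (l \<le> (kernel_op n P ^^ (s + t)) f y)) x \<le> 1"
      using Suc.prems(1) by (intro kernel_op_pow_le[OF P]) auto
    then show ?thesis using True by simp
  next
    case False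
    show ?thesis
    proof (cases t)
      case 0
      then have "(kernel_op n P ^^ t) (\<lambda>y. of_bool (l \<le> (kernel_op n P ^^ (s + t)) f y)) x = 0"
        using False by simp
      then show ?thesis
        using exceed_prob_bounds[OF P Suc.prems(1), of f l "Suc r" s] by linarith
    next
      case (Suc u)
      have "kernel_op n P ((kernel_op n P ^^ u) (\<lambda>y. of_bool (l \<le> (kernel_op n P ^^ (Suc s + u)) f y))) x
          \<le> kernel_op n P (exceed_prob n P f l r (Suc s)) x"
        using Suc Suc.prems by (intro kernel_op_mono[OF P] Suc.IH) auto
      then show ?thesis using False Suc by simp
    qed
  qed
qed simp

text \<open>Doob's maximal inequality: for the stationary reversible chain, the values of
  \<open>(kernel_op n P ^^ t) f\<close> at \<open>X_t\<close> form a martingale in reversed time.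
  The induction decomposes by the last exceedance and uses self-adjointness to shift one power of
  the kernel.\<close>

lemma mean_exceed_prob_le:
  assumes P: "P \<in> transition_mats n" and \<mu>: "\<mu> \<in> prob_vecs n"
    and rev: "\<And>i j. i < n \<Longrightarrow> j < n \<Longrightarrow> \<mu> $ i * P $$ (i, j) = \<mu> $ j * P $$ (j, i)"
  shows "l * mean n \<mu> (exceed_prob n P f l r s)
     \<le> mean n \<mu> (\<lambda>x. (kernel_op n P ^^ s) f x * exceed_prob n P f l r s x)"
proof (induction r arbitrary: s)
  case 0
  then show ?case by (simp add: mean_def)
next
  case (Suc r)
  let ?F = "(kernel_op n P ^^ s) f" and ?v = "exceed_prob n P f l r (Suc s)"
  define w where "w = kernel_op n P ?v"
  \<comment> \<open>\<open>b x\<close> is the probability that time \<open>s\<close> is the last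
    exceedance, and \<open>w x\<close> that a later one occurs.\<close>
  define b where "b x = (of_bool (l \<le> ?F x) :: real) * (1 - w x)" for x
  have w1: "w x \<le> 1" if "x < n" for x
    unfolding w_def
    using kernel_op_pow_le[OF P, of ?v 1 x 1] exceed_prob_bounds[OF P] that by simp
  have eq: "exceed_prob n P f l (Suc r) s x = b x + w x" for x
    by (simp add: b_def w_def)
  have "mean n \<mu> w = mean n \<mu> (\<lambda>i. 1 * kernel_op n P ?v i)"
    by (simp add: w_def)
  also have "\<dots> = mean n \<mu> (\<lambda>i. ?v i * kernel_op n P (\<lambda>_. 1) i)"
    by (rule reversible_mean[OF rev])
  also have "\<dots> = mean n \<mu> ?v"
    by (intro mean_cong) (simp add: kernel_op_const[OF P])
  finally have w_mean: "mean n \<mu> w = mean n \<mu> ?v" .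
  have "l * mean n \<mu> (exceed_prob n P f l (Suc r) s)
      = mean n \<mu> (\<lambda>x. l * b x) + l * mean n \<mu> ?v"
    unfolding eq mean_add mean_cmult w_mean by (simp add: distrib_left)
  also have "\<dots> \<le> mean n \<mu> (\<lambda>x. ?F x * b x) + mean n \<mu> (\<lambda>x. (kernel_op n P ^^ Suc s) f x * ?v x)"
    using w1 by (intro add_mono mean_mono[OF \<mu>] Suc) (auto simp: b_def intro!: mult_right_mono)
  also have "mean n \<mu> (\<lambda>x. (kernel_op n P ^^ Suc s) f x * ?v x) = mean n \<mu> (\<lambda>x. ?F x * w x)"
    using reversible_mean[OF rev, where f="?F" and g="?v"] by (simp add: mult.commute w_def)
  also have "mean n \<mu> (\<lambda>x. ?F x * b x) + mean n \<mu> (\<lambda>x. ?F x * w x)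
      = mean n \<mu> (\<lambda>x. ?F x * exceed_prob n P f l (Suc r) s x)"
    unfolding eq by (simp add: mean_add[symmetric] distrib_left)
  finally show ?case .
qed

text \<open>Since \<open>(kernel_op n P ^^ (2 * s)) f = (kernel_op n P ^^ s) ((kernel_op n P ^^ s) f)\<close>, and the
  inner function is at most \<open>l\<close> off the set where it exceeds \<open>l\<close>, all even powers are controlled
  by a single exceedance probability.\<close>

lemma reversible_maximal_inequality:
  assumes P: "P \<in> transition_mats n" and \<mu>: "\<mu> \<in> prob_vecs n"
    and rev: "\<And>i j. i < n \<Longrightarrow> j < n \<Longrightarrow> \<mu> $ i * P $$ (i, j) = \<mu> $ j * P $$ (j, i)"
    and f: "\<And>x. x < n \<Longrightarrow> 0 \<le> f x \<and> f x \<le> 1" and l: "0 < l"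
  obtains g where "mean n \<mu> g \<le> l + 2 * mean n \<mu> f / l"
    "\<And>t x. t \<le> N \<Longrightarrow> x < n \<Longrightarrow> (kernel_op n P ^^ t) f x \<le> g x"
proof -
  let ?K = "kernel_op n P"
  \<comment> \<open>\<open>Suc N\<close> makes the window the times \<open>0\<close> to
    \<open>N\<close>.\<close>
  define u where "u = exceed_prob n P f l (Suc N) 0"
  have u: "0 \<le> u x" "u x \<le> 1" if "x < n" for x
    using exceed_prob_bounds[OF P that] by (auto simp: u_def simp del: exceed_prob.simps)
  have Ku: "0 \<le> ?K u x" if "x < n" for x
    using kernel_op_pow_ge[OF P, of 0 u x 1] u that by simp
  have even: "(?K ^^ (s + s)) f x \<le> l + u x" if "s \<le> N" "x < n" for s x
  proof -
    let ?E = "\<lambda>y. of_bool (l \<le> (?K ^^ s) f y) :: real"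
    have "(?K ^^ (s + s)) f x = (?K ^^ s) ((?K ^^ s) f) x"
      by (simp add: funpow_add)
    also have "\<dots> \<le> (?K ^^ s) (\<lambda>y. l + ?E y) x"
    proof (intro kernel_op_pow_mono[OF P] that)
      fix y assume "y < n"
      then show "(?K ^^ s) f y \<le> l + ?E y"
        using kernel_op_pow_le[OF P, of f 1 y s] f l by (cases "l \<le> (?K ^^ s) f y") (auto simp: add_increasing)
    qed
    also have "\<dots> = l + (?K ^^ s) ?E x"
      by (simp add: kernel_op_pow_add kernel_op_pow_const[OF P that(2)])
    also have "\<dots> \<le> l + u x"
      using kernel_op_pow_exceed_le[OF P that(2), of s "Suc N" l 0 f] that(1) by (simp add: u_def)
    finally show ?thesis .
  qed
  \<comment> \<open>Even powers are at most \<open>l + u\<close>; one more step bounds odd powers by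
    \<open>l + ?K u\<close>. The sum covers both, and \<open>u\<close> and \<open>?K u\<close> have
    equal mean.\<close>
  define g where "g x = l + (u x + ?K u x)" for x
  have bound: "(?K ^^ t) f x \<le> g x" if "t \<le> N" "x < n" for t x
  proof (cases "even t")
    case True
    then obtain s where "t = s + s" by (metis evenE mult_2)
    then show ?thesis using even[of s x] that Ku[of x] by (simp add: g_def)
  next
    case False
    then obtain s where s: "t = Suc (s + s)" by (metis oddE mult_2 Suc_eq_plus1)
    have "(?K ^^ t) f x = ?K ((?K ^^ (s + s)) f) x" by (simp add: s)
    also have "\<dots> \<le> ?K (\<lambda>y. l + u y) x"
      using even[of s] that s by (intro kernel_op_mono[OF P]) auto
    also have "\<dots> = l + ?K u x"
      by (simp add: kernel_op_add kernel_op_const[OF P that(2)])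
    finally show ?thesis using u(1)[OF that(2)] by (simp add: g_def)
  qed
  have "mean n \<mu> (?K u) = mean n \<mu> (\<lambda>i. u i * ?K (\<lambda>_. 1) i)"
    using reversible_mean[OF rev, where f=u and g="\<lambda>_. 1"] by simp
  also have "\<dots> = mean n \<mu> u"
    by (intro mean_cong) (simp add: kernel_op_const[OF P])
  finally have Ku_mean: "mean n \<mu> (?K u) = mean n \<mu> u" .
  have "l * mean n \<mu> u \<le> mean n \<mu> (\<lambda>x. f x * u x)"
    using mean_exceed_prob_le[OF P \<mu> rev, of l f "Suc N" 0] by (simp add: u_def del: exceed_prob.simps)
  also have "\<dots> \<le> mean n \<mu> f"
    using f u by (intro mean_mono[OF \<mu>]) (simp add: mult_left_le)
  finally have "mean n \<mu> u \<le> mean n \<mu> f / l"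
    using l by (simp add: pos_le_divide_eq mult.commute)
  then have "mean n \<mu> g \<le> l + 2 * mean n \<mu> f / l"
    unfolding g_def mean_add Ku_mean using mean_const[OF \<mu>] by simp
  then show ?thesis using that bound by blast
qed

section \<open>Restart perturbations\<close>

lemma restart_perturb_carrier:
  "P \<in> carrier_mat n n \<Longrightarrow> restart_perturb n P \<alpha> \<sigma> \<in> carrier_mat n n"
  unfolding restart_perturb_def carrier_mat_def by simp

lemma restart_perturb_index:
  assumes "P \<in> carrier_mat n n" "\<sigma> \<in> carrier_vec n" "i < n" "j < n"
  shows "restart_perturb n P \<alpha> \<sigma> $$ (i, j) = (1 - \<alpha>) * P $$ (i, j) + \<alpha> * \<sigma> $ j"
proof -
  have "(mat_of_cols n [vec n (\<lambda>_. 1)] * mat_of_rows n [\<sigma>]) $$ (i, j) = \<sigma> $ j"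
    using assms by (simp add: scalar_prod_def mat_of_cols_def mat_of_rows_def)
  then show ?thesis
    using assms unfolding restart_perturb_def by simp
qed

lemma kernel_op_restart_perturb:
  assumes "P \<in> carrier_mat n n" "\<sigma> \<in> carrier_vec n" "i < n"
  shows "kernel_op n (restart_perturb n P \<alpha> \<sigma>) f i = (1 - \<alpha>) * kernel_op n P f i + \<alpha> * mean n \<sigma> f"
proof -
  have "kernel_op n (restart_perturb n P \<alpha> \<sigma>) f i
      = (\<Sum>j<n. (1 - \<alpha>) * (P $$ (i, j) * f j) + \<alpha> * (\<sigma> $ j * f j))"
    unfolding kernel_op_def using assms
    by (intro sum.cong) (auto simp: restart_perturb_index distrib_right)
  then show ?thesis
    by (simp add: sum.distrib kernel_op_def mean_def flip: sum_distrib_left)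
qed

text \<open>The perturbed matrix dominates \<open>(1 - \<alpha>) P\<close> entrywise, and its powers
  dominate the powers of that, so irreducibility is inherited. Laziness gives a positive diagonal,
  hence return time 1 and aperiodicity. Each row moves by \<open>\<alpha>\<close> times a difference
  of two distributions.\<close>

lemma restart_perturb_in_perturb_ball:
  assumes P: "P \<in> ergodic_mats n" "lazy_mat n P" and \<sigma>: "\<sigma> \<in> prob_vecs n"
    and \<alpha>: "0 < \<alpha>" "\<alpha> < 1" and n: "1 \<le> n"
  shows "restart_perturb n P \<alpha> \<sigma> \<in> perturb_ball n P \<alpha>"
proof -
  let ?R = "restart_perturb n P \<alpha> \<sigma>"
  have Pt: "P \<in> transition_mats n" and irr: "irreducible_mat n P"
    using P by (auto simp: ergodic_mats_def)
  note P' = transition_matsD[OF Pt] and \<sigma>' = prob_vecsD[OF \<sigma>]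
  note Pp = transition_matsD[OF transition_mats_pow[OF Pt]]
  note Rc = restart_perturb_carrier[OF P'(1), of \<alpha> \<sigma>]
  note R = restart_perturb_index[OF P'(1) \<sigma>'(1), where \<alpha>=\<alpha>]
  have R_ge: "(1 - \<alpha>) * P $$ (i, j) \<le> ?R $$ (i, j)" if "i < n" "j < n" for i j
    using R[OF that] \<sigma>'(2)[OF that(2)] \<alpha> by simp
  have Rt: "?R \<in> transition_mats n"
    unfolding transition_mats_iff
  proof (intro conjI allI impI)
    fix i assume i: "i < n"
    have "(\<Sum>j<n. ?R $$ (i, j)) = (\<Sum>j<n. (1 - \<alpha>) * P $$ (i, j) + \<alpha> * \<sigma> $ j)"
      using i by (intro sum.cong) (auto simp: R)
    also have "\<dots> = 1"
      by (simp add: sum.distrib P'(3)[OF i] \<sigma>'(3) flip: sum_distrib_left)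
    finally show "(\<Sum>j<n. ?R $$ (i, j)) = 1" .
    fix j assume j: "j < n"
    have "0 \<le> (1 - \<alpha>) * P $$ (i, j)" using P'(2)[OF i j] \<alpha> by simp
    then show "0 \<le> ?R $$ (i, j)" using R_ge[OF i j] by simp
  qed (rule Rc)
  note R' = transition_matsD[OF Rt] and Rp = transition_matsD[OF transition_mats_pow[OF Rt]]
  have pow_ge: "(1 - \<alpha>) ^ t * (P ^\<^sub>m t) $$ (i, j) \<le> (?R ^\<^sub>m t) $$ (i, j)" if "i < n" "j < n" for t i j
    using that
  proof (induction t arbitrary: j)
    case 0
    then show ?case using P'(1) Rc by simp
  next
    case (Suc t)
    have "(1 - \<alpha>) ^ Suc t * (P ^\<^sub>m Suc t) $$ (i, j)
        = (\<Sum>k<n. ((1 - \<alpha>) ^ t * (P ^\<^sub>m t) $$ (i, k)) * ((1 - \<alpha>) * P $$ (k, j)))"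
      unfolding pow_mat_Suc_index[OF P'(1) Suc.prems] by (simp add: sum_distrib_left mult_ac)
    also have "\<dots> \<le> (\<Sum>k<n. (?R ^\<^sub>m t) $$ (i, k) * ?R $$ (k, j))"
      using Suc R_ge P' Rp \<alpha> by (intro sum_mono mult_mono) auto
    also have "\<dots> = (?R ^\<^sub>m Suc t) $$ (i, j)"
      by (rule pow_mat_Suc_index[OF Rc Suc.prems, symmetric])
    finally show ?case .
  qed
  have "irreducible_mat n ?R"
    unfolding irreducible_mat_def
  proof (intro allI impI)
    fix i j assume ij: "i < n" "j < n"
    then obtain t where "0 < (P ^\<^sub>m t) $$ (i, j)" using irr unfolding irreducible_mat_def by blast
    then have "0 < (1 - \<alpha>) ^ t * (P ^\<^sub>m t) $$ (i, j)" using \<alpha> by simp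
    then show "\<exists>t. 0 < (?R ^\<^sub>m t) $$ (i, j)" using pow_ge[OF ij, of t] by (intro exI[of _ t]) simp
  qed
  moreover have "aperiodic_mat n ?R"
    unfolding aperiodic_mat_def
  proof (intro allI impI)
    fix i assume i: "i < n"
    have "0 < (1 - \<alpha>) * P $$ (i, i)"
    proof -
      have "0 < P $$ (i, i)" using P(2) i unfolding lazy_mat_def by fastforce
      then show ?thesis using \<alpha> by simp
    qed
    then have "0 < (?R ^\<^sub>m 1) $$ (i, i)"
      using R_ge[OF i i] Rc by (simp add: left_mult_one_mat[OF Rc])
    then have "Gcd {t. 1 \<le> t \<and> 0 < (?R ^\<^sub>m t) $$ (i, i)} dvd 1"
      by (intro Gcd_dvd) auto
    then show "Gcd {t. 1 \<le> t \<and> 0 < (?R ^\<^sub>m t) $$ (i, i)} = 1" by simp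
  qed
  ultimately have "?R \<in> ergodic_mats n" using Rt by (simp add: ergodic_mats_def)
  moreover have "tv_dist n (unit_vec n i \<^sub>v* P) (unit_vec n i \<^sub>v* ?R) \<le> \<alpha>" if i: "i < n" for i
  proof -
    have prob: "unit_vec n i \<^sub>v* A \<in> prob_vecs n" if "A \<in> transition_mats n" for A
    proof -
      note A = transition_matsD[OF that]
      show ?thesis
        using A(2)[OF i] A(3)[OF i] vec_mult_mat_carrier[OF A(1)]
        by (auto simp: prob_vecs_def unit_vec_mult_mat_index[OF A(1) i])
    qed
    show ?thesis
    proof (rule tv_dist_le[OF prob[OF Pt] prob[OF Rt]])
      fix A :: "nat set"
      have "kernel_op n P (indicator A) i \<le> 1" "0 \<le> mean n \<sigma> (indicator A)"
        using kernel_op_pow_le[OF Pt, of "indicator A" 1 i 1] i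
          mean_mono[OF \<sigma>, of "\<lambda>_. 0" "indicator A"] mean_const[OF \<sigma>, of 0]
        by (auto simp: indicator_def)
      then have "\<alpha> * (kernel_op n P (indicator A) i - mean n \<sigma> (indicator A)) \<le> \<alpha> * 1"
        using \<alpha> by (intro mult_left_mono) auto
      then show "mean n (unit_vec n i \<^sub>v* P) (indicator A) - mean n (unit_vec n i \<^sub>v* ?R) (indicator A) \<le> \<alpha>"
        unfolding mean_unit_vec[OF P'(1) i] mean_unit_vec[OF Rc i]
          kernel_op_restart_perturb[OF P'(1) \<sigma>'(1) i]
        by (simp add: algebra_simps)
    qed
  qed
  ultimately show ?thesis
    using n by (auto simp: perturb_ball_def lessThan_empty_iff)
qed

text \<open>This unrolls \<open>\<rho> = \<alpha> * (\<Sum>k<m. (1 - \<alpha>) ^ k * \<sigma> P ^ k) + (1 - \<alpha>) ^ m * \<rho> P ^ m\<close>.\<close>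

lemma mean_restart_stationary_le:
  assumes P: "P \<in> transition_mats n" and i: "i < n" and \<alpha>: "0 \<le> \<alpha>" "\<alpha> \<le> 1"
    and \<rho>: "\<rho> \<in> prob_vecs n" "\<rho> \<^sub>v* restart_perturb n P \<alpha> (unit_vec n i) = \<rho>"
    and "0 \<le> \<delta>" "\<And>k. k < m \<Longrightarrow> (kernel_op n P ^^ k) h i \<le> \<delta>" "\<And>x. x < n \<Longrightarrow> h x \<le> 1"
  shows "mean n \<rho> h \<le> \<delta> + (1 - \<alpha>) ^ m"
  using assms(7-9)
proof (induction m arbitrary: h)
  case 0
  have "mean n \<rho> h \<le> mean n \<rho> (\<lambda>_. 1)" using 0 by (intro mean_mono \<rho>)
  then show ?case using 0 \<rho> by (simp add: mean_const)
next
  case (Suc m)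
  have "mean n (unit_vec n i) h = h i"
  proof -
    have "mean n (unit_vec n i) h = (\<Sum>j<n. if j = i then h j else 0)"
      unfolding mean_def using i by (intro sum.cong) auto
    then show ?thesis using i by simp
  qed
  moreover have "mean n \<rho> h = mean n \<rho> (kernel_op n (restart_perturb n P \<alpha> (unit_vec n i)) h)"
    using mean_vec_mult_mat[OF restart_perturb_carrier[OF transition_matsD(1)[OF P]] prob_vecsD(1)[OF \<rho>(1)]]
    by (metis \<rho>(2))
  ultimately have "mean n \<rho> h = mean n \<rho> (\<lambda>x. (1 - \<alpha>) * kernel_op n P h x + \<alpha> * h i)"
    using kernel_op_restart_perturb[OF transition_matsD(1)[OF P], of "unit_vec n i"]
    by (simp cong: mean_cong)
  also have "\<dots> = (1 - \<alpha>) * mean n \<rho> (kernel_op n P h) + \<alpha> * h i"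
    by (simp add: mean_add mean_cmult mean_const[OF \<rho>(1)])
  \<comment> \<open>The hypotheses at powers \<open>Suc k\<close> are those of the induction
    hypothesis for \<open>kernel_op n P h\<close>; power 0 bounds the restart term.\<close>
  also have "\<dots> \<le> (1 - \<alpha>) * (\<delta> + (1 - \<alpha>) ^ m) + \<alpha> * \<delta>"
  proof (intro add_mono mult_left_mono Suc.IH)
    show "(kernel_op n P ^^ k) (kernel_op n P h) i \<le> \<delta>" if "k < m" for k
      using Suc.prems(2)[of "Suc k"] that by (simp add: funpow_swap1)
    show "kernel_op n P h x \<le> 1" if "x < n" for x
      using kernel_op_pow_le[OF P, of h 1 x 1] Suc.prems(3) that by simp
    show "h i \<le> \<delta>" using Suc.prems(2)[of 0] by simp
  qed (use \<alpha> Suc.prems in auto)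
  also have "\<dots> = \<delta> + (1 - \<alpha>) ^ Suc m" by (simp add: algebra_simps)
  finally show ?case .
qed

text \<open>The restart state is one that has not mixed shortly before the mixing time: some set \<open>A\<close> of
  stationary mass at least \<open>1 - \<delta>\<close> is rarely occupied at time \<open>t_mix n P (1 - \<delta>) - 1\<close>. By the maximal
  inequality, most states of \<open>A\<close> stay in \<open>A\<close> with high probability at every later time, so
  these states are rarely visited at all earlier times, too.\<close>

lemma restart_perturb_lower_bound:
  assumes P: "P \<in> ergodic_mats n" "lazy_mat n P" "reversible_mat n P"
    and \<alpha>: "0 < \<alpha>" "\<alpha> < 1" and n: "1 \<le> n" and \<delta>: "0 < \<delta>" "\<delta> < 1"
  obtains i where "i < n"
    "1 - 3 * sqrt \<delta> - \<delta> - (1 - \<alpha>) ^ t_mix n P (1 - \<delta>)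
      \<le> tv_dist n (stationary_dist n P) (stationary_dist n (restart_perturb n P \<alpha> (unit_vec n i)))"
proof (cases "t_mix n P (1 - \<delta>)")
  case 0
  \<comment> \<open>At mixing time 0 the power is 1, so the claimed bound is at most 0 and any state
    serves.\<close>
  have "1 - 3 * sqrt \<delta> - \<delta> - (1 - \<alpha>) ^ t_mix n P (1 - \<delta>) \<le> 0"
    using \<delta>(1) real_sqrt_gt_zero[OF \<delta>(1)] unfolding 0 power_0 by linarith
  then show ?thesis
    using that[of 0] n tv_dist_nonneg[of n "stationary_dist n P"
      "stationary_dist n (restart_perturb n P \<alpha> (unit_vec n 0))"] by simp
next
  case (Suc T)
  let ?K = "kernel_op n P" and ?\<pi> = "stationary_dist n P"
  have Pt: "P \<in> transition_mats n" using P by (simp add: ergodic_mats_def)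
  note P' = transition_matsD[OF Pt]
  note \<pi> = stationary_dist_props[OF P(1) n]
  have "\<not> mix_dist n P T \<le> 1 - \<delta>"
    using Suc unfolding t_mix_def by (intro not_less_Least) simp
  moreover obtain i where i: "i < n"
    "mix_dist n P T = tv_dist n (unit_vec n i \<^sub>v* (P ^\<^sub>m T)) ?\<pi>"
    using mix_dist_attained[OF n] .
  ultimately have far: "1 - \<delta> < tv_dist n ?\<pi> (unit_vec n i \<^sub>v* (P ^\<^sub>m T))"
    by (simp add: tv_dist_commute)
  have prob: "unit_vec n i \<^sub>v* (P ^\<^sub>m T) \<in> prob_vecs n"
  proof -
    note A = transition_matsD[OF transition_mats_pow[OF Pt, of T]]
    show ?thesis
      using A(2)[OF i(1)] A(3)[OF i(1)] vec_mult_mat_carrier[OF A(1)]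
      by (auto simp: prob_vecs_def unit_vec_mult_mat_index[OF A(1) i(1)])
  qed
  obtain A where A: "1 - \<delta> < mean n ?\<pi> (indicator A) - (?K ^^ T) (indicator A) i"
    using tv_dist_attained[OF \<pi>(1) prob] far by (metis mean_unit_vec_pow[OF P'(1) i(1)])
  have ind: "0 \<le> indicat_real A x \<and> indicat_real A x \<le> 1" for x by (simp add: indicator_def)
  define f where "f x = 1 - indicat_real A x" for x
  have "0 \<le> (?K ^^ T) (indicator A) i"
    using ind i by (intro kernel_op_pow_ge[OF Pt]) auto
  then have f_mean: "mean n ?\<pi> f \<le> \<delta>"
    using A unfolding f_def by (simp add: mean_diff mean_const[OF \<pi>(1)])
  have "mean n ?\<pi> (indicator A) \<le> mean n ?\<pi> (\<lambda>_. 1)" using ind by (intro mean_mono[OF \<pi>(1)]) auto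
  then have KT: "(?K ^^ T) (indicator A) i \<le> \<delta>"
    using A by (simp add: mean_const[OF \<pi>(1)])
  \<comment> \<open>Applied to the indicator \<open>f\<close> of the complement of \<open>A\<close>.
    As \<open>f\<close> has mean at most \<open>\<delta>\<close>, the level
    \<open>sqrt \<delta>\<close> makes both terms of the bound of order
    \<open>sqrt \<delta>\<close>, in total \<open>3 * sqrt \<delta>\<close>.\<close>
  obtain g where g: "mean n ?\<pi> g \<le> sqrt \<delta> + 2 * mean n ?\<pi> f / sqrt \<delta>"
      "\<And>t x. t \<le> T \<Longrightarrow> x < n \<Longrightarrow> (?K ^^ t) f x \<le> g x"
  proof (rule reversible_maximal_inequality[OF Pt \<pi>(1), of f "sqrt \<delta>" T])
    show "?\<pi> $ i * P $$ (i, j) = ?\<pi> $ j * P $$ (j, i)" if "i < n" "j < n" for i j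
      using P(3) that unfolding reversible_mat_def by blast
    show "0 \<le> f x \<and> f x \<le> 1" for x using ind[of x] by (simp add: f_def)
  qed (use \<delta> in auto)
  have "2 * mean n ?\<pi> f / sqrt \<delta> \<le> 2 * \<delta> / sqrt \<delta>"
    using f_mean \<delta> by (intro divide_right_mono) auto
  also have "\<dots> = 2 * sqrt \<delta>"
    using real_div_sqrt[of \<delta>] \<delta>(1) by (simp only: times_divide_eq_right[symmetric] less_imp_le)
  finally have g_mean: "mean n ?\<pi> g \<le> 3 * sqrt \<delta>" using g(1) by simp
  \<comment> \<open>Truncation at 0 makes \<open>h\<close> an admissible
    \<open>[0, 1]\<close>-valued test function for the total variation distance.\<close>
  define h where "h x = max 0 (1 - g x)" for x
  have h_le: "h x \<le> (?K ^^ s) (indicator A) x" if "s \<le> T" "x < n" for s x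
  proof -
    have "(?K ^^ s) (\<lambda>x. f x + indicator A x) x = 1"
      using kernel_op_pow_const[OF Pt that(2), of s 1] by (simp add: f_def)
    then have "1 - g x \<le> (?K ^^ s) (indicator A) x"
      using g(2)[OF that] by (simp add: kernel_op_pow_add)
    moreover have "0 \<le> (?K ^^ s) (indicator A) x"
      using ind that by (intro kernel_op_pow_ge[OF Pt]) auto
    ultimately show ?thesis by (simp add: h_def)
  qed
  have h1: "0 \<le> h x \<and> h x \<le> 1" if "x < n" for x
    using order_trans[OF h_le[of 0 x]] that ind[of x] max.cobounded1[of 0 "1 - g x"]
    by (simp add: h_def[symmetric])
  have Kh: "(?K ^^ k) h i \<le> \<delta>" if "k < Suc T" for k
  proof -
    \<comment> \<open>The power \<open>s = T - k\<close> is chosen so that the exponents add up to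
      \<open>T\<close>; this is where one \<open>h\<close> must lie below all the powers at
      once.\<close>
    have "(?K ^^ k) h i \<le> (?K ^^ k) ((?K ^^ (T - k)) (indicator A)) i"
      using h_le i(1) by (intro kernel_op_pow_mono[OF Pt]) auto
    also have "\<dots> = (?K ^^ T) (indicator A) i"
      using that by (simp flip: funpow_add[unfolded comp_def, THEN fun_cong] add: less_Suc_eq_le)
    finally show ?thesis using KT by simp
  qed
  let ?R = "restart_perturb n P \<alpha> (unit_vec n i)"
  have "unit_vec n i \<in> prob_vecs n"
    using i(1) by (simp add: prob_vecs_def)
  then have R: "?R \<in> ergodic_mats n"
    using restart_perturb_in_perturb_ball[OF P(1,2) _ \<alpha> n] perturb_ballD(1) by blast
  note \<rho> = stationary_dist_props[OF R n]
  have "mean n (stationary_dist n ?R) h \<le> \<delta> + (1 - \<alpha>) ^ Suc T"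
    using \<alpha> \<delta> h1 by (intro mean_restart_stationary_le[OF Pt i(1) _ _ \<rho>] Kh) auto
  moreover have "1 - 3 * sqrt \<delta> \<le> mean n ?\<pi> h"
  proof -
    have "mean n ?\<pi> (\<lambda>x. 1 - g x) \<le> mean n ?\<pi> h"
      by (intro mean_mono[OF \<pi>(1)]) (simp add: h_def)
    then show ?thesis using g_mean by (simp add: mean_diff mean_const[OF \<pi>(1)])
  qed
  moreover have "mean n ?\<pi> h - mean n (stationary_dist n ?R) h \<le> tv_dist n ?\<pi> (stationary_dist n ?R)"
    by (rule mean_diff_le_tv_dist[OF h1])
  ultimately show ?thesis
    using that[OF i(1)] Suc by simp
qed

section \<open>Consequences of cutoff\<close>

text \<open>Cutoff compares the levels \<open>\<gamma>\<close> and \<open>1 - \<gamma>\<close>. For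
  small \<open>\<gamma>\<close> both \<open>\<epsilon>\<close> and \<open>\<eta>\<close> lie between
  them, so by monotonicity of the mixing time the ratio is squeezed between two quotients tending to
  1.\<close>

lemma cutoff_t_mix_ratio:
  assumes P: "\<And>n. 1 \<le> n \<Longrightarrow> P n \<in> ergodic_mats n" "\<And>n. 1 \<le> n \<Longrightarrow> lazy_mat n (P n)"
    and cutoff: "exhibits_cutoff P"
    and \<epsilon>: "0 < \<epsilon>" "\<epsilon> < 1" and \<eta>: "0 < \<eta>" "\<eta> < 1"
  shows "(\<lambda>n. real (t_mix n (P n) \<eta>) / real (t_mix n (P n) \<epsilon>)) \<longlonglongrightarrow> 1"
proof -
  define \<gamma> where "\<gamma> = min (min \<epsilon> (1 - \<epsilon>)) (min \<eta> (1 - \<eta>)) / 2"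
  have "2 * \<gamma> \<le> \<epsilon>" "2 * \<gamma> \<le> 1 - \<epsilon>" "2 * \<gamma> \<le> \<eta>" "2 * \<gamma> \<le> 1 - \<eta>" "0 < \<gamma>"
    using \<epsilon> \<eta> by (simp_all add: \<gamma>_def min.coboundedI1 min.coboundedI2)
  then have \<gamma>: "0 < \<gamma>" "\<gamma> < 1 / 2" "\<gamma> \<le> \<epsilon>" "\<epsilon> \<le> 1 - \<gamma>" "\<gamma> \<le> \<eta>" "\<eta> \<le> 1 - \<gamma>"
    using \<epsilon> \<eta> by linarith+
  define a where "a n = real (t_mix n (P n) (1 - \<gamma>))" for n
  define b where "b n = real (t_mix n (P n) \<gamma>)" for n
  have lim: "(\<lambda>n. b n / a n) \<longlonglongrightarrow> 1"
    using cutoff \<gamma> unfolding exhibits_cutoff_def a_def b_def by blast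
  have lim': "(\<lambda>n. a n / b n) \<longlonglongrightarrow> 1"
    using tendsto_inverse[OF lim] by simp
  \<comment> \<open>Division by zero gives 0, so a quotient above \<open>1 / 2\<close> forces a
    positive denominator.\<close>
  have "eventually (\<lambda>n. 1 / 2 < b n / a n) sequentially"
    using lim by (rule order_tendstoD) simp
  then have ev: "eventually (\<lambda>n. 1 \<le> n \<and> 0 < a n) sequentially"
    using eventually_ge_at_top[of 1]
  proof eventually_elim
    case (elim n)
    then have "a n \<noteq> 0" by auto
    then show ?case using elim by (simp add: a_def)
  qed
  have between: "a n \<le> real (t_mix n (P n) \<zeta>) \<and> real (t_mix n (P n) \<zeta>) \<le> b n"
    if "1 \<le> n" "\<gamma> \<le> \<zeta>" "\<zeta> \<le> 1 - \<gamma>" for n \<zeta>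
    using t_mix_antimono[OF P[OF that(1)] that(1), of \<zeta> "1 - \<gamma>"]
      t_mix_antimono[OF P[OF that(1)] that(1), of \<gamma> \<zeta>] that \<gamma> by (simp add: a_def b_def)
  show ?thesis
  proof (rule tendsto_sandwich[OF _ _ lim' lim])
    show "eventually (\<lambda>n. a n / b n \<le> real (t_mix n (P n) \<eta>) / real (t_mix n (P n) \<epsilon>)) sequentially"
      using ev
    proof eventually_elim
      case (elim n)
      then show ?case using between[of n \<eta>] between[of n \<epsilon>] \<gamma> by (intro frac_le) auto
    qed
    show "eventually (\<lambda>n. real (t_mix n (P n) \<eta>) / real (t_mix n (P n) \<epsilon>) \<le> b n / a n) sequentially"
      using ev
    proof eventually_elim
      case (elim n)
      then show ?case using between[of n \<eta>] between[of n \<epsilon>] \<gamma> by (intro frac_le) auto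
    qed
  qed
qed

text \<open>If the mixing times stayed at most \<open>K\<close>, cutoff would force \<open>t_mix n (P n) \<eta> \<le> 2 * K\<close> also for
  \<open>\<eta> < 1 / 2 ^ (2 * K)\<close>, but lazy chains cannot mix that fast.\<close>

lemma cutoff_t_mix_at_top:
  assumes P: "\<And>n. 1 \<le> n \<Longrightarrow> P n \<in> ergodic_mats n" "\<And>n. 1 \<le> n \<Longrightarrow> lazy_mat n (P n)"
    and cutoff: "exhibits_cutoff P"
    and \<epsilon>: "0 < \<epsilon>" "\<epsilon> < 1"
  shows "filterlim (\<lambda>n. real (t_mix n (P n) \<epsilon>)) at_top sequentially"
  unfolding filterlim_sequentially_iff_filterlim_real[symmetric] filterlim_at_top
proof
  fix K :: nat
  \<comment> \<open>With this choice \<open>1 / 2 ^ (2 * K)\<close> is \<open>2 * \<eta>\<close>,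
    whereas mixing to level \<open>\<eta>\<close> within \<open>2 * K\<close> steps would bound it
    by \<open>\<eta> + 1 / n < 2 * \<eta>\<close>.\<close>
  define \<eta> :: real where "\<eta> = 1 / 2 ^ (2 * K + 1)"
  have \<eta>: "0 < \<eta>" "\<eta> < 1" using one_less_power[of "2::real" "2 * K + 1"] by (auto simp: \<eta>_def)
  have lim: "(\<lambda>n. real (t_mix n (P n) \<eta>) / real (t_mix n (P n) \<epsilon>)) \<longlonglongrightarrow> 1"
    by (rule cutoff_t_mix_ratio[OF P cutoff \<epsilon> \<eta>])
  have "eventually (\<lambda>n. real (t_mix n (P n) \<eta>) / real (t_mix n (P n) \<epsilon>) < 2) sequentially"
    "eventually (\<lambda>n. 1 / 2 < real (t_mix n (P n) \<eta>) / real (t_mix n (P n) \<epsilon>)) sequentially"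
    by (rule order_tendstoD[OF lim], simp)+
  moreover have "eventually (\<lambda>n. 1 / real n < \<eta>) sequentially"
    using \<eta>(1) by (intro order_tendstoD[OF lim_1_over_n])
  ultimately show "eventually (\<lambda>n. K \<le> t_mix n (P n) \<epsilon>) sequentially"
    using eventually_ge_at_top[of 1]
  proof eventually_elim
    case (elim n)
    show ?case
    proof (rule ccontr)
      assume "\<not> K \<le> t_mix n (P n) \<epsilon>"
      moreover have "0 < t_mix n (P n) \<epsilon>" using elim(2) by (intro gr0I) auto
      ultimately have "t_mix n (P n) \<eta> \<le> 2 * K"
        using elim(1) by (simp add: pos_divide_less_eq)
      then have "1 / 2 ^ (2 * K) \<le> 1 / (2::real) ^ t_mix n (P n) \<eta>"
        by (intro divide_left_mono power_increasing) auto
      also have "\<dots> \<le> \<eta> + 1 / real n"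
        using lazy_mix_dist_lower[OF P[OF elim(4)] elim(4), of "t_mix n (P n) \<eta>"]
          mix_dist_t_mix[OF P[OF elim(4)] elim(4) \<eta>(1)] by linarith
      also have "\<dots> < 2 * \<eta>" using elim(3) by simp
      finally show False by (simp add: \<eta>_def)
    qed
  qed
qed

section \<open>Exponential estimates and the asymptotic upper and lower bounds\<close>

text \<open>Rests on \<open>1 / (1 - \<alpha>) \<le> exp (\<alpha> / (1 - \<alpha>))\<close>. The
  correction \<open>1 - \<alpha>\<close> in the exponent disappears in the limit when
  \<open>\<alpha>\<close> tends to 0.\<close>

lemma one_minus_power_ge_exp:
  fixes \<alpha> :: real
  assumes "0 < \<alpha>" "\<alpha> < 1"
  shows "exp (- (\<alpha> * real t) / (1 - \<alpha>)) \<le> (1 - \<alpha>) ^ t"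
proof -
  have "1 / (1 - \<alpha>) = 1 + \<alpha> / (1 - \<alpha>)"
    using assms by (simp add: field_simps)
  also have "\<dots> \<le> exp (\<alpha> / (1 - \<alpha>))" by (rule exp_ge_add_one_self)
  finally have "exp (- (\<alpha> / (1 - \<alpha>))) \<le> 1 - \<alpha>"
    using assms by (simp add: exp_minus field_simps)
  then have "exp (- (\<alpha> / (1 - \<alpha>))) ^ t \<le> (1 - \<alpha>) ^ t"
    by (intro power_mono) auto
  then show ?thesis by (simp add: exp_of_nat_mult[symmetric] mult_ac)
qed

lemma one_minus_power_le_exp:
  fixes \<alpha> :: real
  assumes "0 < \<alpha>" "\<alpha> < 1"
  shows "(1 - \<alpha>) ^ t \<le> exp (- (\<alpha> * real t))"
proof -
  have "(1 - \<alpha>) ^ t \<le> exp (- \<alpha>) ^ t"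
    using assms exp_ge_add_one_self[of "- \<alpha>"] by (intro power_mono) auto
  then show ?thesis by (simp add: exp_of_nat_mult[symmetric] mult_ac)
qed

text \<open>Uses \<open>stationary_perturb_le\<close> at the mixing time for some
  \<open>\<delta> < e\<close>. Since \<open>\<alpha> t\<close> converges while \<open>t\<close>
  diverges, \<open>\<alpha>\<close> tends to 0; by cutoff \<open>\<alpha> t\<close> has the limit
  \<open>c\<close> at level \<open>\<delta>\<close> as well.\<close>

lemma cutoff_stationary_perturb_upper:
  fixes c :: real
  assumes P: "\<And>n. 1 \<le> n \<Longrightarrow> P n \<in> ergodic_mats n" "\<And>n. 1 \<le> n \<Longrightarrow> lazy_mat n (P n)"
    and cutoff: "exhibits_cutoff P"
    and \<alpha>: "\<And>n. 1 \<le> n \<Longrightarrow> 0 < \<alpha> n \<and> \<alpha> n < 1"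
    and \<epsilon>: "0 < \<epsilon>" "\<epsilon> < 1"
    and lim: "(\<lambda>n. \<alpha> n * real (t_mix n (P n) \<epsilon>)) \<longlonglongrightarrow> c"
    and Q: "\<forall>n\<ge>1. Q n \<in> perturb_ball n (P n) (\<alpha> n)"
    and e: "0 < e"
  shows "eventually (\<lambda>n. tv_dist n (stationary_dist n (P n)) (stationary_dist n (Q n))
           < 1 - exp (- c) + e) sequentially"
proof -
  define \<delta> where "\<delta> = min (1 / 2) (e / 2)"
  have \<delta>: "0 < \<delta>" "\<delta> < 1" "\<delta> < e" using e by (auto simp: \<delta>_def)
  let ?t = "\<lambda>n. t_mix n (P n)"
  have top: "filterlim (\<lambda>n. real (?t n \<epsilon>)) at_top sequentially"
    by (rule cutoff_t_mix_at_top[OF P cutoff \<epsilon>])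
  then have pos: "eventually (\<lambda>n. 0 < real (?t n \<epsilon>)) sequentially"
    unfolding filterlim_at_top_dense by blast
  have "(\<lambda>n. \<alpha> n * real (?t n \<epsilon>) * inverse (real (?t n \<epsilon>))) \<longlonglongrightarrow> c * 0"
    by (intro tendsto_mult lim tendsto_inverse_0_at_top top)
  moreover have "eventually (\<lambda>n. \<alpha> n * real (?t n \<epsilon>) * inverse (real (?t n \<epsilon>)) = \<alpha> n) sequentially"
    using pos by eventually_elim simp
  ultimately have \<alpha>0: "\<alpha> \<longlonglongrightarrow> 0"
    by (simp add: tendsto_cong)
  have "(\<lambda>n. \<alpha> n * real (?t n \<epsilon>) * (real (?t n \<delta>) / real (?t n \<epsilon>))) \<longlonglongrightarrow> c * 1"
    by (intro tendsto_mult lim cutoff_t_mix_ratio[OF P cutoff \<epsilon> \<delta>(1,2)])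
  moreover have "eventually (\<lambda>n. \<alpha> n * real (?t n \<epsilon>) * (real (?t n \<delta>) / real (?t n \<epsilon>))
      = \<alpha> n * real (?t n \<delta>)) sequentially"
    using pos by eventually_elim simp
  ultimately have lim\<delta>: "(\<lambda>n. \<alpha> n * real (?t n \<delta>)) \<longlonglongrightarrow> c"
    by (simp add: tendsto_cong)
  have "(\<lambda>n. \<delta> + (1 - exp (- (\<alpha> n * real (?t n \<delta>)) / (1 - \<alpha> n)))) \<longlonglongrightarrow> \<delta> + (1 - exp (- c / (1 - 0)))"
    by (intro tendsto_intros lim\<delta> \<alpha>0) auto
  then have "eventually (\<lambda>n. \<delta> + (1 - exp (- (\<alpha> n * real (?t n \<delta>)) / (1 - \<alpha> n))) < 1 - exp (- c) + e)
      sequentially"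
    using \<delta> by (intro order_tendstoD(2)) auto
  then show ?thesis
    using eventually_ge_at_top[of 1]
  proof eventually_elim
    case (elim n)
    note n = elim(2)
    have "tv_dist n (stationary_dist n (P n)) (stationary_dist n (Q n))
        \<le> mix_dist n (P n) (?t n \<delta>) + (1 - (1 - \<alpha> n) ^ ?t n \<delta>)"
      using Q n \<alpha>[OF n] by (intro stationary_perturb_le P) auto
    also have "\<dots> \<le> \<delta> + (1 - exp (- (\<alpha> n * real (?t n \<delta>)) / (1 - \<alpha> n)))"
      using \<alpha>[OF n] by (intro add_mono diff_left_mono mix_dist_t_mix[OF P[OF n] n \<delta>(1)]
          one_minus_power_ge_exp) auto
    finally show ?case using elim(1) by simp
  qed
qed

text \<open>\<open>E\<close> stands for \<open>exp (- c)\<close>, so that \<open>E = 0\<close>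
  covers infinite \<open>c\<close>. The state from \<open>restart_perturb_lower_bound\<close>
  depends on \<open>\<delta>\<close>, but one sequence \<open>Q\<close> must serve every
  \<open>e\<close>; restarting at a state of maximal distance does so.\<close>

lemma cutoff_restart_perturb_lower:
  assumes P: "\<And>n. 1 \<le> n \<Longrightarrow> P n \<in> ergodic_mats n" "\<And>n. 1 \<le> n \<Longrightarrow> lazy_mat n (P n)"
      "\<And>n. 1 \<le> n \<Longrightarrow> reversible_mat n (P n)"
    and \<alpha>: "\<And>n. 1 \<le> n \<Longrightarrow> 0 < \<alpha> n \<and> \<alpha> n < 1"
    and lim: "\<And>\<eta>. 0 < \<eta> \<Longrightarrow> \<eta> < 1 \<Longrightarrow> (\<lambda>n. exp (- (\<alpha> n * real (t_mix n (P n) \<eta>)))) \<longlonglongrightarrow> E"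
  obtains Q where
    "\<And>n. 1 \<le> n \<Longrightarrow> Q n \<in> perturb_ball n (P n) (\<alpha> n) \<and>
       (\<exists>\<sigma>\<in>prob_vecs n. Q n = restart_perturb n (P n) (\<alpha> n) \<sigma>)"
    "\<And>e. 0 < e \<Longrightarrow> eventually (\<lambda>n. 1 - E - e <
       tv_dist n (stationary_dist n (P n)) (stationary_dist n (Q n))) sequentially"
proof -
  define R where "R n i = restart_perturb n (P n) (\<alpha> n) (unit_vec n i)" for n i
  define F where "F n i = tv_dist n (stationary_dist n (P n)) (stationary_dist n (R n i))" for n i
  have "\<exists>i<n. \<forall>j<n. F n j \<le> F n i" if "1 \<le> n" for n
  proof -
    have "Max (F n ` {..<n}) \<in> F n ` {..<n}"
      using that by (intro Max_in) (auto simp: lessThan_empty_iff)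
    then obtain i where i: "i < n" "F n i = Max (F n ` {..<n})" by auto
    have "F n j \<le> F n i" if "j < n" for j
      unfolding i(2) using that by (intro Max_ge) auto
    then show ?thesis using i(1) by blast
  qed
  then obtain k where k: "\<And>n. 1 \<le> n \<Longrightarrow> k n < n" "\<And>n j. 1 \<le> n \<Longrightarrow> j < n \<Longrightarrow> F n j \<le> F n (k n)"
    by metis
  define Q where "Q n = R n (k n)" for n
  show ?thesis
  proof
    fix n :: nat assume n: "1 \<le> n"
    have "unit_vec n (k n) \<in> prob_vecs n" using k(1)[OF n] by (simp add: prob_vecs_def)
    then show "Q n \<in> perturb_ball n (P n) (\<alpha> n) \<and>
        (\<exists>\<sigma>\<in>prob_vecs n. Q n = restart_perturb n (P n) (\<alpha> n) \<sigma>)"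
      unfolding Q_def R_def using \<alpha>[OF n] by (auto intro: restart_perturb_in_perturb_ball P n)
  next
    fix e :: real assume e: "0 < e"
    \<comment> \<open>With \<open>r\<close> the square root of \<open>\<delta>\<close>, the error
      \<open>3 * r + r\<^sup>2\<close> is at most \<open>3.5 * r\<close>, which is below
      \<open>8 * r \<le> e\<close>.\<close>
    define \<delta> where "\<delta> = (min (1 / 2) (e / 8))\<^sup>2"
    define r where "r = min (1 / 2) (e / 8)"
    have r: "0 < r" "r \<le> 1 / 2" "8 * r \<le> e" using e by (auto simp: r_def)
    have \<delta>r: "\<delta> = r\<^sup>2" "sqrt \<delta> = r" using r by (simp_all add: \<delta>_def r_def)
    have "r\<^sup>2 \<le> r * (1 / 2)" unfolding power2_eq_square using r by (intro mult_left_mono) auto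
    then have \<delta>: "0 < \<delta>" "\<delta> < 1" "3 * sqrt \<delta> + \<delta> < e"
      using r \<delta>r by auto
    have "(\<lambda>n. 1 - 3 * sqrt \<delta> - \<delta> - exp (- (\<alpha> n * real (t_mix n (P n) (1 - \<delta>)))))
        \<longlonglongrightarrow> 1 - 3 * sqrt \<delta> - \<delta> - E"
      using \<delta> by (intro tendsto_diff tendsto_const lim) auto
    then have "eventually (\<lambda>n. 1 - E - e
        < 1 - 3 * sqrt \<delta> - \<delta> - exp (- (\<alpha> n * real (t_mix n (P n) (1 - \<delta>))))) sequentially"
      using \<delta> by (intro order_tendstoD(1)) auto
    then show "eventually (\<lambda>n. 1 - E - e <
        tv_dist n (stationary_dist n (P n)) (stationary_dist n (Q n))) sequentially"
      using eventually_ge_at_top[of 1]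
    proof eventually_elim
      case (elim n)
      note n = elim(2)
      obtain i where i: "i < n" "1 - 3 * sqrt \<delta> - \<delta> - (1 - \<alpha> n) ^ t_mix n (P n) (1 - \<delta>) \<le> F n i"
        unfolding F_def R_def
        using restart_perturb_lower_bound[OF P[OF n] _ _ n \<delta>(1,2)] \<alpha>[OF n] by metis
      have "(1 - \<alpha> n) ^ t_mix n (P n) (1 - \<delta>) \<le> exp (- (\<alpha> n * real (t_mix n (P n) (1 - \<delta>))))"
        using \<alpha>[OF n] by (intro one_minus_power_le_exp) auto
      then show ?case
        using elim(1) i(2) k(2)[OF n i(1)] unfolding Q_def F_def by linarith
    qed
  qed
qed

section \<open>The three regimes of the limit \<open>c\<close>\<close>

theorem theorem1:
  fixes P :: "nat \<Rightarrow> real mat" and \<alpha> :: "nat \<Rightarrow> real" and \<epsilon> :: real and c :: ereal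
  assumes "\<And>n. 1 \<le> n \<Longrightarrow> P n \<in> ergodic_mats n"
    and "\<And>n. 1 \<le> n \<Longrightarrow> 0 < \<alpha> n \<and> \<alpha> n < 1"
    and "0 < \<epsilon>" and "\<epsilon> < 1"
    and "exhibits_cutoff P"
    and "\<And>n. 1 \<le> n \<Longrightarrow> lazy_mat n (P n)"
    and "\<And>n. 1 \<le> n \<Longrightarrow> reversible_mat n (P n)"
    and "0 \<le> c"
    and "(\<lambda>n. ereal (\<alpha> n * real (t_mix n (P n) \<epsilon>))) \<longlonglongrightarrow> c"
  shows "(c = 0 \<longrightarrow>
           (\<forall>Q. (\<forall>n\<ge>1. Q n \<in> perturb_ball n (P n) (\<alpha> n)) \<longrightarrow>
             (\<lambda>n. tv_dist n (stationary_dist n (P n)) (stationary_dist n (Q n))) \<longlonglongrightarrow> 0))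
       \<and> (0 < c \<and> c < \<infinity> \<longrightarrow>
           (\<forall>Q. (\<forall>n\<ge>1. Q n \<in> perturb_ball n (P n) (\<alpha> n)) \<longrightarrow>
             limsup (\<lambda>n. ereal (tv_dist n (stationary_dist n (P n)) (stationary_dist n (Q n))))
               \<le> ereal (1 - exp (- real_of_ereal c)))
         \<and> (\<exists>Q. (\<forall>n\<ge>1. Q n \<in> perturb_ball n (P n) (\<alpha> n)
                   \<and> (\<exists>\<sigma>\<in>prob_vecs n. Q n = restart_perturb n (P n) (\<alpha> n) \<sigma>)) \<and>
             ereal (1 - exp (- real_of_ereal c))
               \<le> liminf (\<lambda>n. ereal (tv_dist n (stationary_dist n (P n)) (stationary_dist n (Q n))))))
       \<and> (c = \<infinity> \<longrightarrow>
           (\<exists>Q. (\<forall>n\<ge>1. Q n \<in> perturb_ball n (P n) (\<alpha> n)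
                   \<and> (\<exists>\<sigma>\<in>prob_vecs n. Q n = restart_perturb n (P n) (\<alpha> n) \<sigma>)) \<and>
             (\<lambda>n. tv_dist n (stationary_dist n (P n)) (stationary_dist n (Q n))) \<longlonglongrightarrow> 1))"
proof -
  note erg = assms(1) and \<alpha> = assms(2) and \<epsilon> = assms(3,4) and cutoff = assms(5)
    and lazy = assms(6) and rev = assms(7) and lim = assms(9)
  let ?t = "\<lambda>n. t_mix n (P n)"
  let ?tv = "\<lambda>Q n. tv_dist n (stationary_dist n (P n)) (stationary_dist n (Q n))"
  have pos: "eventually (\<lambda>n. 0 < real (?t n \<epsilon>)) sequentially"
    using cutoff_t_mix_at_top[OF erg lazy cutoff \<epsilon>] unfolding filterlim_at_top_dense by blast
  have ratio: "eventually (\<lambda>n. \<alpha> n * real (?t n \<epsilon>) * (real (?t n \<eta>) / real (?t n \<epsilon>))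
      = \<alpha> n * real (?t n \<eta>)) sequentially" for \<eta>
    using pos by eventually_elim simp
  \<comment> \<open>Serves \<open>c = 0\<close> and \<open>0 < c < \<infinity>\<close> alike; for
    \<open>c = 0\<close> the bound reduces to \<open>e\<close>.\<close>
  have upper: "eventually (\<lambda>n. ?tv Q n < 1 - exp (- real_of_ereal c) + e) sequentially"
    if "c < \<infinity>" "\<forall>n\<ge>1. Q n \<in> perturb_ball n (P n) (\<alpha> n)" "0 < e" for Q e
  proof -
    obtain c' where c': "c = ereal c'" using assms(8) \<open>c < \<infinity>\<close> by (cases c) auto
    then show ?thesis
      using cutoff_stationary_perturb_upper[OF erg lazy cutoff \<alpha> \<epsilon> _ that(2,3), of c'] lim by simp
  qed
  have part1: "(\<lambda>n. ?tv Q n) \<longlonglongrightarrow> 0"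
    if "c = 0" "\<forall>n\<ge>1. Q n \<in> perturb_ball n (P n) (\<alpha> n)" for Q
  proof (rule order_tendstoI)
    fix a :: real
    show "eventually (\<lambda>n. a < ?tv Q n) sequentially" if "a < 0"
      using that tv_dist_nonneg by (intro always_eventually allI) (rule less_le_trans)
    show "eventually (\<lambda>n. ?tv Q n < a) sequentially" if "0 < a"
      using upper[of Q a] \<open>c = 0\<close> \<open>\<forall>n\<ge>1. _ n\<close> that by simp
  qed
  have part2a: "limsup (\<lambda>n. ereal (?tv Q n)) \<le> ereal (1 - exp (- real_of_ereal c))"
    if "c < \<infinity>" "\<forall>n\<ge>1. Q n \<in> perturb_ball n (P n) (\<alpha> n)" for Q
  proof (rule ereal_le_epsilon2)
    fix e :: real assume "0 < e"
    have "limsup (\<lambda>n. ereal (?tv Q n)) \<le> ereal (1 - exp (- real_of_ereal c) + e)"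
      by (rule Limsup_bounded, rule eventually_mono[OF upper[OF that \<open>0 < e\<close>]]) simp
    then show "limsup (\<lambda>n. ereal (?tv Q n)) \<le> ereal (1 - exp (- real_of_ereal c)) + ereal e"
      by simp
  qed
  have part2b: "\<exists>Q. (\<forall>n\<ge>1. Q n \<in> perturb_ball n (P n) (\<alpha> n)
                   \<and> (\<exists>\<sigma>\<in>prob_vecs n. Q n = restart_perturb n (P n) (\<alpha> n) \<sigma>)) \<and>
             ereal (1 - exp (- real_of_ereal c)) \<le> liminf (\<lambda>n. ereal (?tv Q n))"
    if "c < \<infinity>"
  proof -
    obtain c' where c': "c = ereal c'" using assms(8) \<open>c < \<infinity>\<close> by (cases c) auto
    have decay: "(\<lambda>n. exp (- (\<alpha> n * real (?t n \<eta>)))) \<longlonglongrightarrow> exp (- c')" if "0 < \<eta>" "\<eta> < 1" for \<eta>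
    proof -
      have "(\<lambda>n. \<alpha> n * real (?t n \<epsilon>) * (real (?t n \<eta>) / real (?t n \<epsilon>))) \<longlonglongrightarrow> c' * 1"
        using lim c' by (intro tendsto_mult cutoff_t_mix_ratio[OF erg lazy cutoff \<epsilon> that]) simp
      then have "(\<lambda>n. \<alpha> n * real (?t n \<eta>)) \<longlonglongrightarrow> c'"
        using tendsto_cong[OF ratio] by simp
      then show ?thesis by (intro tendsto_intros)
    qed
    obtain Q where Q: "\<And>n. 1 \<le> n \<Longrightarrow> Q n \<in> perturb_ball n (P n) (\<alpha> n) \<and>
        (\<exists>\<sigma>\<in>prob_vecs n. Q n = restart_perturb n (P n) (\<alpha> n) \<sigma>)"
      and low: "\<And>e. 0 < e \<Longrightarrow> eventually (\<lambda>n. 1 - exp (- c') - e < ?tv Q n) sequentially"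
      by (rule cutoff_restart_perturb_lower[where P=P and \<alpha>=\<alpha> and E="exp (- c')"])
        (use erg lazy rev \<alpha> decay in blast)+
    have "ereal (1 - exp (- c')) \<le> liminf (\<lambda>n. ereal (?tv Q n))"
    proof (rule ereal_le_epsilon2)
      fix e :: real assume "0 < e"
      have "ereal (1 - exp (- c') - e) \<le> liminf (\<lambda>n. ereal (?tv Q n))"
        by (rule Liminf_bounded, rule eventually_mono[OF low[OF \<open>0 < e\<close>]]) simp
      then have "ereal (1 - exp (- c') - e) + ereal e \<le> liminf (\<lambda>n. ereal (?tv Q n)) + ereal e"
        by (rule add_right_mono)
      then show "ereal (1 - exp (- c')) \<le> liminf (\<lambda>n. ereal (?tv Q n)) + ereal e"
        by simp
    qed
    then show ?thesis using Q c' by auto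
  qed
  have part3: "\<exists>Q. (\<forall>n\<ge>1. Q n \<in> perturb_ball n (P n) (\<alpha> n)
                   \<and> (\<exists>\<sigma>\<in>prob_vecs n. Q n = restart_perturb n (P n) (\<alpha> n) \<sigma>)) \<and>
             (\<lambda>n. ?tv Q n) \<longlonglongrightarrow> 1"
    if "c = \<infinity>"
  proof -
    have top: "filterlim (\<lambda>n. \<alpha> n * real (?t n \<epsilon>)) at_top sequentially"
      using lim that by (simp add: tendsto_PInfty_eq_at_top)
    \<comment> \<open>Cutoff transfers divergence from level \<open>\<epsilon>\<close> to every
      level \<open>\<eta>\<close>, since the ratio of the mixing times has the positive limit
      1.\<close>
    have decay: "(\<lambda>n. exp (- (\<alpha> n * real (?t n \<eta>)))) \<longlonglongrightarrow> 0" if "0 < \<eta>" "\<eta> < 1" for \<eta>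
    proof -
      have "filterlim (\<lambda>n. (real (?t n \<eta>) / real (?t n \<epsilon>)) * (\<alpha> n * real (?t n \<epsilon>))) at_top sequentially"
        using cutoff_t_mix_ratio[OF erg lazy cutoff \<epsilon> that]
        by (rule filterlim_tendsto_pos_mult_at_top) (simp_all add: top)
      then have "filterlim (\<lambda>n. \<alpha> n * real (?t n \<eta>)) at_top sequentially"
        using filterlim_cong[OF refl refl ratio] by (simp add: mult.commute)
      then show ?thesis
        by (intro filterlim_compose[OF exp_at_bot] filterlim_compose[OF filterlim_uminus_at_bot_at_top])
    qed
    obtain Q where Q: "\<And>n. 1 \<le> n \<Longrightarrow> Q n \<in> perturb_ball n (P n) (\<alpha> n) \<and>
        (\<exists>\<sigma>\<in>prob_vecs n. Q n = restart_perturb n (P n) (\<alpha> n) \<sigma>)"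
      and low: "\<And>e. 0 < e \<Longrightarrow> eventually (\<lambda>n. 1 - 0 - e < ?tv Q n) sequentially"
      by (rule cutoff_restart_perturb_lower[where P=P and \<alpha>=\<alpha> and E=0])
        (use erg lazy rev \<alpha> decay in blast)+
    have le1: "?tv Q n \<le> 1" if "1 \<le> n" for n
      using stationary_dist_props(1)[OF erg[OF that] that]
        stationary_dist_props(1)[OF perturb_ballD(1) that] Q[OF that] by (intro tv_dist_le_1) auto
    have "(\<lambda>n. ?tv Q n) \<longlonglongrightarrow> 1"
    proof (rule order_tendstoI)
      fix a :: real
      show "eventually (\<lambda>n. a < ?tv Q n) sequentially" if "a < 1"
        using low[of "1 - a"] that by simp
      show "eventually (\<lambda>n. ?tv Q n < a) sequentially" if "1 < a"
        using eventually_ge_at_top[of 1] by eventually_elim (use le1 that in force)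
    qed
    then show ?thesis using Q by blast
  qed
  show ?thesis using part1 part2a part2b part3 by blast
qed

end
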